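(* With probability one there exists $n_0$ such that for every $n\ge n_0$ the function $\mathbb R^2\ni(\alpha',\theta')\mapsto Q_n(\mathbf Y_n;\alpha',\theta')$ has a unique global minimizer, denoted $(\tilde\alpha_n,\tilde\theta_n)$. Moreover, for every $(\alpha,\theta)\in(0,1)\times\mathbb N$, $$\mathbb P\Big(\lim_{n\to\infty}\tilde\alpha_n=\alpha\Big)=1,\qquad \mathbb P\Big(\lim_{n\to\infty}\tilde\theta_n=Y_s-\frac{\alpha}{1+\alpha^2}(Y_{s-1}+Y_{s+1})-\frac{1-\alpha}{1+\alpha^2}\mu_\varepsilon\Big)=1 .$$
   Context: INAR(1) process: Let $\alpha\in(0,1)$. Let $(\varepsilon_k)_{k\in\mathbb N}$ be i.i.d. non-negative integer-valued random variables with $\mathbb E\varepsilon_1^2<\infty$ and $\mathbb P(\varepsilon_1\ne 0)>0$; write $\mu_\varepsilon=\mathbb E\varepsilon_1$ (assumed known) and $\sigma_\varepsilon^2=\operatorname{Var}\varepsilon_1$. For each $k\in\mathbb N$ let $(\xi_{k,j})_{j\in\mathbb N}$ be i.i.d. Bernoulli random variables with mean $\alpha$, these sequences being mutually independent and independent of $(\varepsilon_k)$. Let $X_0$ be a non-negative integer-valued random variable with $\mathbb E X_0^2<\infty$, independent of all $\xi_{k,j}$ and $\varepsilon_k$, and set $X_k=\sum_{j=1}^{X_{k-1}}\xi_{k,j}+\varepsilon_k$ for $k\in\mathbb N$. Additive outlier: fix a known time $s\in\mathbb N$ and an unknown size $\theta\in\mathbb N$, and let $Y_k=X_k+\delta_{k,s}\theta$,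 $k\in\mathbb Z_+$ ($\delta$ the Kronecker delta). Write $\mathbf Y_n=(Y_0,\dots,Y_n)$ and $\mathbf y_n=(y_0,\dots,y_n)\in\mathbb R^{n+1}$. For $n\ge s+1$ and $\alpha',\theta'\in\mathbb R$ define $$Q_n(\mathbf y_n;\alpha',\theta')=\sum_{\substack{k=1\\k\notin\{s,s+1\}}}^n(y_k-\alpha'y_{k-1}-\mu_\varepsilon)^2+(y_s-\alpha'y_{s-1}-\mu_\varepsilon-\theta')^2+(y_{s+1}-\alpha'y_s-\mu_\varepsilon+\alpha'\theta')^2 .$$ *)

theory Defs
  imports "HOL-Probability.Probability"
begin

text \<open>Index type for the jointly independent family of primitive random variables:
  the initial value X_0, the innovations eps_k, and the Bernoulli counting variables xi_{k,j}.\<close>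
datatype inar_idx = IX0 | IEps nat | IXi nat nat

definition inar_index :: "inar_idx set" where
  "inar_index = {IX0} \<union> {IEps k | k. k \<ge> 1} \<union> {IXi k j | k j. k \<ge> 1 \<and> j \<ge> 1}"

fun inar :: "nat \<Rightarrow> (nat \<Rightarrow> nat) \<Rightarrow> (nat \<Rightarrow> nat \<Rightarrow> nat) \<Rightarrow> nat \<Rightarrow> nat" where
  "inar x0 e xi 0 = x0"
| "inar x0 e xi (Suc k) = (\<Sum>j = 1..inar x0 e xi k. xi (Suc k) j) + e (Suc k)"

definition outlier_Y :: "nat \<Rightarrow> nat \<Rightarrow> (nat \<Rightarrow> nat) \<Rightarrow> nat \<Rightarrow> nat" where
  "outlier_Y s \<theta> X k = X k + (if k = s then \<theta> else 0)"

definition Qn :: "real \<Rightarrow> nat \<Rightarrow> nat \<Rightarrow> (nat \<Rightarrow> real) \<Rightarrow> real \<Rightarrow> real \<Rightarrow> real" where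
  "Qn mu s n y a t =
     (\<Sum>k \<in> {1..n} - {s, s+1}. (y k - a * y (k-1) - mu)^2)
     + (y s - a * y (s-1) - mu - t)^2
     + (y (s+1) - a * y s - mu + a * t)^2"

definition is_min_Qn :: "real \<Rightarrow> nat \<Rightarrow> nat \<Rightarrow> (nat \<Rightarrow> real) \<Rightarrow> real \<times> real \<Rightarrow> bool" where
  "is_min_Qn mu s n y p \<longleftrightarrow> (\<forall>q. Qn mu s n y (fst p) (snd p) \<le> Qn mu s n y (fst q) (snd q))"

definition argmin_Qn :: "real \<Rightarrow> nat \<Rightarrow> nat \<Rightarrow> (nat \<Rightarrow> real) \<Rightarrow> real \<times> real" where
  "argmin_Qn mu s n y = (THE p. is_min_Qn mu s n y p)"

end

theory Submission
  imports Defs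
begin

text \<open>Minimising \<open>Q\<^sub>n\<close> over \<open>\<theta>'\<close> first leaves \<open>D\<^sub>n (\<alpha>' - r\<^sub>n)\<^sup>2 + g(\<alpha>')\<close> plus a constant, where \<open>D\<^sub>n\<close> is
  the sum of the \<open>y\<^bsub>k-1\<^esub>\<^sup>2\<close> over \<open>k \<notin> {s, s+1}\<close>, \<open>r\<^sub>n\<close> is the least squares estimate, and \<open>g \<ge> 0\<close> does not depend
  on \<open>n\<close> and becomes convex after adding a multiple of \<open>\<alpha>'\<^sup>2\<close>. So everything follows from
  \<open>D\<^sub>n \<rightarrow> \<infinity>\<close> and \<open>r\<^sub>n \<rightarrow> \<alpha>\<close>.

  The error \<open>r\<^sub>n - \<alpha>\<close> is a sum of \<open>X\<^sub>k M\<^bsub>k+1\<^esub>\<close> divided by \<open>D\<^sub>n\<close>, with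
  \<open>M\<^bsub>k+1\<^esub> = X\<^bsub>k+1\<^esub> - \<alpha> X\<^sub>k - \<mu>\<close>. By Kronecker's lemma it suffices that the martingale with increments
  \<open>X\<^sub>k M\<^bsub>k+1\<^esub> / G\<^sub>k\<close>, where \<open>G\<^sub>k = 1 + X\<^sub>0\<^sup>2 + \<dots> + X\<^sub>k\<^sup>2\<close>, converges almost surely. No ergodicity or
  third moment is needed for this: the conditional variance of \<open>M\<^bsub>k+1\<^esub>\<close> is at most a multiple of
  \<open>X\<^sub>k + 1 \<le> 2 G\<^sub>k\<^bsup>1/2\<^esup>\<close>, and \<open>X\<^sub>k\<^sup>2 / G\<^sub>k\<^bsup>3/2\<^esup>\<close> always has sum at most \<open>2\<close>, so the martingale is
  bounded in \<open>L\<^sup>2\<close>.\<close>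

section \<open>Deterministic analysis of the least squares criterion\<close>

text \<open>Abel summation against the tails \<open>r\<close> of the convergent series turns the
  weighted sum into the sum of \<open>c k * r k\<close> minus \<open>b n * r (Suc n)\<close>. After
  division by \<open>b n\<close> the first part is an average of a null sequence with nonnegative
  weights, the second a tail; both vanish.\<close>

lemma kronecker_lemma:
  fixes b d :: "nat \<Rightarrow> real"
  assumes d: "summable d" and b: "mono b" "b 0 \<ge> 0" "filterlim b at_top sequentially"
  shows "(\<lambda>n. (\<Sum>k\<le>n. b k * d k) / b n) \<longlonglongrightarrow> 0"
proof -
  define r where "r k = suminf d - (\<Sum>i<k. d i)" for k
  \<comment> \<open>The first weight is \<open>b 0\<close> rather than 0, so that the weights up to
    \<open>n\<close> add up to exactly \<open>b n\<close>.\<close>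
  define c where "c k = (case k of 0 \<Rightarrow> b 0 | Suc j \<Rightarrow> b (Suc j) - b j)" for k
  have r: "r \<longlonglongrightarrow> 0"
    unfolding r_def using tendsto_diff[OF tendsto_const[of "suminf d"] summable_LIMSEQ[OF d]] by simp
  have c_nonneg: "c k \<ge> 0" for k
    using b(1,2) by (auto simp: c_def mono_def split: nat.split)
  have sum_c: "(\<Sum>k\<le>n. c k) = b n" for n
    by (induction n) (auto simp: c_def)
  have abel: "(\<Sum>k\<le>n. b k * d k) = (\<Sum>k\<le>n. c k * r k) - b n * r (Suc n)" for n
    by (induction n) (auto simp: c_def r_def algebra_simps)
  have toeplitz: "(\<lambda>n. (\<Sum>k\<le>n. c k * r k) / b n) \<longlonglongrightarrow> 0"
  proof (rule LIMSEQ_I)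
    fix e :: real assume e: "e > 0"
    obtain N where N: "\<And>k. k \<ge> N \<Longrightarrow> \<bar>r k\<bar> < e / 2"
      using LIMSEQ_D[OF r, of "e/2"] e by auto
    \<comment> \<open>\<open>C\<close> bounds the finite block before the tails are small; it is
      fixed, so \<open>b n\<close> eventually makes its share less than half of
      \<open>e\<close>.\<close>
    define C where "C = (\<Sum>k<N. \<bar>c k * r k\<bar>)"
    have "eventually (\<lambda>n. b n > max 0 (2 * C / e)) sequentially"
      using b(3) unfolding filterlim_at_top_dense by blast
    then obtain n0 where n0: "\<And>n. n \<ge> n0 \<Longrightarrow> b n > 0 \<and> b n > 2 * C / e"
      by (auto simp: eventually_sequentially)
    show "\<exists>n0. \<forall>n\<ge>n0. norm ((\<Sum>k\<le>n. c k * r k) / b n - 0) < e"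
    proof (intro exI allI impI)
      fix n assume "n \<ge> max n0 N"
      then have n: "n \<ge> n0" "n \<ge> N" by auto
      have bn: "b n > 0" "C < e / 2 * b n"
        using n0[OF n(1)] e by (auto simp: field_simps)
      have "\<bar>\<Sum>k\<le>n. c k * r k\<bar> \<le> (\<Sum>k\<le>n. \<bar>c k * r k\<bar>)" by (rule sum_abs)
      also have "\<dots> = C + (\<Sum>k\<in>{N..n}. \<bar>c k * r k\<bar>)"
      proof -
        have "{..n} = {..<N} \<union> {N..n}" using n by auto
        then show ?thesis unfolding C_def by (simp add: sum.union_disjoint ivl_disj_int)
      qed
      also have "(\<Sum>k\<in>{N..n}. \<bar>c k * r k\<bar>) \<le> (\<Sum>k\<in>{N..n}. c k * (e / 2))"
      proof (rule sum_mono)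
        fix k assume "k \<in> {N..n}"
        then have "c k * \<bar>r k\<bar> \<le> c k * (e / 2)"
          using N[of k] c_nonneg by (intro mult_left_mono) auto
        then show "\<bar>c k * r k\<bar> \<le> c k * (e / 2)" using c_nonneg[of k] by (simp add: abs_mult)
      qed
      also have "\<dots> \<le> (\<Sum>k\<le>n. c k * (e / 2))"
        using c_nonneg e by (intro sum_mono2) auto
      also have "\<dots> = e / 2 * b n"
        by (subst sum_distrib_right[symmetric]) (simp add: sum_c)
      finally show "norm ((\<Sum>k\<le>n. c k * r k) / b n - 0) < e"
        using bn by (simp add: abs_divide divide_less_eq)
    qed
  qed
  have nz: "eventually (\<lambda>n. b n > 0) sequentially"
    using b(3) by (simp add: filterlim_at_top_dense)
  have "(\<lambda>n. (\<Sum>k\<le>n. c k * r k) / b n - r (Suc n)) \<longlonglongrightarrow> 0 - 0"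
    by (intro tendsto_diff toeplitz LIMSEQ_Suc r)
  then have "(\<lambda>n. (\<Sum>k\<le>n. c k * r k) / b n - r (Suc n)) \<longlonglongrightarrow> 0" by simp
  moreover have "eventually (\<lambda>n. (\<Sum>k\<le>n. c k * r k) / b n - r (Suc n) = (\<Sum>k\<le>n. b k * d k) / b n) sequentially"
    using nz by eventually_elim (simp add: abel field_simps)
  ultimately show ?thesis by (rule Lim_transform_eventually)
qed

text \<open>Discrete form of integrating t to the power -3/2: each summand is a rectangle under this
  decreasing curve between \<open>E k\<close> and \<open>E (Suc k)\<close>, and the integral
  \<open>2 / sqrt (E k) - 2 / sqrt (E (Suc k))\<close> telescopes, starting from
  \<open>E 0 = 1\<close>. The comparison is done by algebra.\<close>

lemma sum_increments_over_powr_three_halves: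
  fixes a :: "nat \<Rightarrow> real"
  assumes "\<And>k. a k \<ge> 0"
  defines "D \<equiv> \<lambda>k. 1 + (\<Sum>i\<le>k. a i)"
  shows "(\<Sum>k<n. a k / (D k * sqrt (D k))) \<le> 2"
proof -
  define E where "E k = 1 + (\<Sum>i<k. a i)" for k
  have DE: "D k = E (Suc k)" for k by (simp add: D_def E_def lessThan_Suc_atMost)
  have E1: "E k \<ge> 1" for k using assms(1) by (simp add: E_def sum_nonneg)
  have step: "a k / (D k * sqrt (D k)) \<le> 2 / sqrt (E k) - 2 / sqrt (E (Suc k))" for k
  proof -
    define u v where "u = sqrt (E k)" and "v = sqrt (E (Suc k))"
    have u: "u \<ge> 1" "u\<^sup>2 = E k" and v: "v\<^sup>2 = E (Suc k)" "v \<ge> 1"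
      using E1[of k] E1[of "Suc k"] by (auto simp: u_def v_def)
    have uv: "u \<le> v" using assms(1)[of k] by (auto simp: u_def v_def E_def)
    have a: "a k = v\<^sup>2 - u\<^sup>2" unfolding u v by (simp add: E_def)
    have "a k / (D k * sqrt (D k)) = (v\<^sup>2 - u\<^sup>2) / v ^ 3"
      unfolding DE a v_def[symmetric] v(1)[symmetric]
      using v(2) by (simp add: power2_eq_square power3_eq_cube)
    \<comment> \<open>After cancelling \<open>v - u\<close> the claim is \<open>(v + u) * u\<close>
      \<le> \<open>2 * v\<^sup>2\<close>, which follows from \<open>u\<close> \<le>
      \<open>v\<close>.\<close>
    also have "\<dots> \<le> 2 / u - 2 / v"
    proof -
      have "(v + u) * u \<le> (v + v) * v" using u v uv by (intro mult_mono) auto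
      then have "(v - u) * ((v + u) * u) \<le> (v - u) * (2 * v\<^sup>2)"
        using uv by (intro mult_left_mono) (auto simp: power2_eq_square)
      then have "(v\<^sup>2 - u\<^sup>2) * u \<le> 2 * (v - u) * v\<^sup>2"
        by (simp add: algebra_simps power2_eq_square)
      then have "(v\<^sup>2 - u\<^sup>2) / v ^ 3 \<le> 2 * (v - u) / (u * v)"
        using u(1) v(2)
        by (simp add: pos_divide_le_eq pos_le_divide_eq power2_eq_square power3_eq_cube)
      also have "\<dots> = 2 / u - 2 / v" using u(1) v(2) by (simp add: field_simps)
      finally show ?thesis .
    qed
    finally show ?thesis by (simp add: u_def v_def)
  qed
  have "(\<Sum>k<n. a k / (D k * sqrt (D k))) \<le> (\<Sum>k<n. 2 / sqrt (E k) - 2 / sqrt (E (Suc k)))"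
    by (intro sum_mono step)
  also have "\<dots> = 2 / sqrt (E 0) - 2 / sqrt (E n)"
    using sum_lessThan_telescope'[of "\<lambda>k. 2 / sqrt (E k)" n] by simp
  also have "\<dots> \<le> 2" using E1[of n] by (simp add: E_def)
  finally show ?thesis .
qed

section \<open>Semiconvexity and one-dimensional minimisation\<close>

text \<open>The rational function has a bounded second derivative, so a large enough multiple of the
  square outweighs its concavity.\<close>

lemma ex_convex_add_square:
  fixes p q :: real
  shows "\<exists>K. convex_on UNIV (\<lambda>a. K * a\<^sup>2 + (p + q * a) / (1 + a\<^sup>2))"
proof -
  \<comment> \<open>Each of the two polynomials in the numerator of the second derivative is at most
    6 times the cubed denominator in absolute value; \<open>2 * K\<close> is the resulting total
    bound.\<close>
  define K where "K = 3 * (\<bar>p\<bar> + \<bar>q\<bar>)"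
  have pos: "1 + x * x > 0" for x :: real
    using zero_le_square[of x] by linarith
  note nz = pos[THEN less_imp_neq, symmetric]
  have "convex_on UNIV (\<lambda>a. K * a\<^sup>2 + (p + q * a) / (1 + a\<^sup>2))"
  proof (rule f''_ge0_imp_convex)
    fix x :: real
    show "((\<lambda>a. K * a\<^sup>2 + (p + q * a) / (1 + a\<^sup>2)) has_real_derivative
        2 * K * x + (q - 2 * p * x - q * x\<^sup>2) / (1 + x\<^sup>2)\<^sup>2) (at x)"
      using nz[of x]
      by (auto intro!: derivative_eq_intros simp: power2_eq_square)
        (simp add: algebra_simps)
    show "((\<lambda>x. 2 * K * x + (q - 2 * p * x - q * x\<^sup>2) / (1 + x\<^sup>2)\<^sup>2) has_real_derivative
        2 * K + (p * (6 * x\<^sup>2 - 2) + q * (2 * x ^ 3 - 6 * x)) / (1 + x\<^sup>2) ^ 3) (at x)"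
      using nz[of x]
      by (auto intro!: derivative_eq_intros simp: power2_eq_square power3_eq_cube)
        (simp add: divide_simps, simp add: algebra_simps)
    have "\<bar>p * (6 * x\<^sup>2 - 2) + q * (2 * x ^ 3 - 6 * x)\<bar> \<le> 2 * K * (1 + x\<^sup>2) ^ 3"
    proof -
      have x1: "2 * \<bar>x\<bar> \<le> 1 + x\<^sup>2" using zero_le_power2[of "\<bar>x\<bar> - 1"] by (simp add: power2_eq_square algebra_simps)
      have mono: "(1 + x\<^sup>2) ^ j \<le> (1 + x\<^sup>2) ^ 3" if "j \<le> 3" for j
        using that by (intro power_increasing) auto
      have "\<bar>6 * x\<^sup>2 - 2\<bar> \<le> 6 * (1 + x\<^sup>2) ^ 1"
        by (simp add: abs_le_iff)
      also have "\<dots> \<le> 6 * (1 + x\<^sup>2) ^ 3" using mono[of 1] by simp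
      finally have "\<bar>6 * x\<^sup>2 - 2\<bar> \<le> 6 * (1 + x\<^sup>2) ^ 3" .
      moreover have "\<bar>2 * x ^ 3 - 6 * x\<bar> \<le> 6 * (1 + x\<^sup>2) ^ 3"
      proof -
        have "2 * x ^ 3 - 6 * x = 2 * x * (x\<^sup>2 - 3)"
          by (simp add: power2_eq_square power3_eq_cube algebra_simps)
        then have "\<bar>2 * x ^ 3 - 6 * x\<bar> = (2 * \<bar>x\<bar>) * \<bar>x\<^sup>2 - 3\<bar>"
          by (simp add: abs_mult)
        also have "\<dots> \<le> (1 + x\<^sup>2) * (6 * (1 + x\<^sup>2))"
          using x1 by (intro mult_mono) (auto simp: abs_le_iff)
        also have "\<dots> = 6 * (1 + x\<^sup>2) ^ 2" by (simp only: power2_eq_square mult_ac)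
        also have "\<dots> \<le> 6 * (1 + x\<^sup>2) ^ 3" using mono[of 2] by simp
        finally show ?thesis .
      qed
      ultimately have "\<bar>p\<bar> * \<bar>6 * x\<^sup>2 - 2\<bar> + \<bar>q\<bar> * \<bar>2 * x ^ 3 - 6 * x\<bar>
          \<le> \<bar>p\<bar> * (6 * (1 + x\<^sup>2) ^ 3) + \<bar>q\<bar> * (6 * (1 + x\<^sup>2) ^ 3)"
        by (intro add_mono mult_left_mono) auto
      then have "\<bar>p * (6 * x\<^sup>2 - 2)\<bar> + \<bar>q * (2 * x ^ 3 - 6 * x)\<bar> \<le> 2 * K * (1 + x\<^sup>2) ^ 3"
        unfolding abs_mult K_def by argo
      then show ?thesis by linarith
    qed
    then have "- (2 * K * (1 + x\<^sup>2) ^ 3) \<le> p * (6 * x\<^sup>2 - 2) + q * (2 * x ^ 3 - 6 * x)"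
      by (simp only: abs_le_iff) linarith
    moreover have "(1 + x\<^sup>2) ^ 3 > 0" using pos[of x] by (simp add: power2_eq_square)
    ultimately have "- (2 * K) \<le> (p * (6 * x\<^sup>2 - 2) + q * (2 * x ^ 3 - 6 * x)) / (1 + x\<^sup>2) ^ 3"
      by (simp add: pos_le_divide_eq)
    then show "2 * K + (p * (6 * x\<^sup>2 - 2) + q * (2 * x ^ 3 - 6 * x)) / (1 + x\<^sup>2) ^ 3 \<ge> 0" by simp
  qed auto
  then show ?thesis ..
qed

text \<open>Existence: beyond distance \<open>L = g r + 1\<close> from \<open>r\<close> the square
  alone exceeds the value \<open>g r\<close> attained at \<open>r\<close>, so a compact interval
  suffices. Uniqueness: \<open>D > K\<close> makes the sum strictly convex, so the midpoint of two
  distinct minimisers would do better.\<close>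

lemma ex1_minimizer_square_plus_semiconvex:
  fixes g :: "real \<Rightarrow> real"
  assumes g: "continuous_on UNIV g" "\<And>a. g a \<ge> 0"
    and conv: "convex_on UNIV (\<lambda>a. K * a\<^sup>2 + g a)" and D: "D > K" "D \<ge> 1"
  shows "\<exists>!a. \<forall>b. D * (a - r)\<^sup>2 + g a \<le> D * (b - r)\<^sup>2 + g b"
proof -
  define q where "q a = D * (a - r)\<^sup>2 + g a" for a
  define L where "L = g r + 1"
  have L: "L \<ge> 1" using g(2)[of r] by (simp add: L_def)
  have "\<exists>a\<in>{r - L..r + L}. \<forall>b\<in>{r - L..r + L}. q a \<le> q b"
    using L unfolding q_def
    by (intro continuous_attains_inf continuous_intros continuous_on_subset[OF g(1)]) auto
  then obtain a where a: "\<And>b. b \<in> {r - L..r + L} \<Longrightarrow> q a \<le> q b" by blast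
  have "q a \<le> q b" for b
  proof (cases "b \<in> {r - L..r + L}")
    case False
    then have "L \<le> \<bar>b - r\<bar>" by auto
    then have "L * 1 \<le> \<bar>b - r\<bar> * \<bar>b - r\<bar>" using L by (intro mult_mono) auto
    then have "1 * L \<le> D * (b - r)\<^sup>2" using D L by (intro mult_mono) (auto simp: power2_eq_square)
    then have "q r \<le> q b" using g(2)[of b] by (simp add: q_def L_def)
    moreover have "q a \<le> q r" using a[of r] L by auto
    ultimately show ?thesis by simp
  qed (use a in auto)
  moreover have "a = a'" if *: "\<And>b. q a \<le> q b" "\<And>b. q a' \<le> q b" for a a'
  proof (rule ccontr)
    assume ne: "a \<noteq> a'"
    \<comment> \<open>\<open>h\<close> is the squared half-distance: passing to the midpoint gains
      exactly \<open>D * h\<close> in the square, while the semiconvex part gives back at most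
      \<open>K * h\<close>.\<close>
    define m h where "m = (a + a') / 2" and "h = ((a - a') / 2)\<^sup>2"
    have "K * m\<^sup>2 + g m \<le> (K * a\<^sup>2 + g a) / 2 + (K * a'\<^sup>2 + g a') / 2"
      using convex_onD[OF conv, of "1/2" a a'] by (simp add: m_def add_divide_distrib)
    moreover have "K * m\<^sup>2 = K * a\<^sup>2 / 2 + K * a'\<^sup>2 / 2 - K * h"
      by (simp add: m_def h_def power2_eq_square field_simps)
    moreover have "D * (m - r)\<^sup>2 = D * (a - r)\<^sup>2 / 2 + D * (a' - r)\<^sup>2 / 2 - D * h"
      by (simp add: m_def h_def power2_eq_square field_simps)
    ultimately have "q m \<le> q a / 2 + q a' / 2 - (D - K) * h"
      unfolding q_def left_diff_distrib[of D K] by argo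
    moreover have "(D - K) * h > 0" using D ne by (simp add: h_def)
    moreover have "q a = q a'" using * by (meson order_antisym)
    ultimately show False using *(1)[of m] by linarith
  qed
  ultimately show ?thesis unfolding q_def[symmetric] by blast
qed

section \<open>Elimination of the outlier size\<close>

text \<open>The best outlier size for a given slope \<open>a\<close>; at the true slope it is the
  limit claimed for the second estimator.\<close>

definition outlier_size_fit :: "real \<Rightarrow> nat \<Rightarrow> (nat \<Rightarrow> real) \<Rightarrow> real \<Rightarrow> real" where
  "outlier_size_fit mu s y a =
     y s - a / (1 + a\<^sup>2) * (y (s - 1) + y (s + 1)) - (1 - a) / (1 + a\<^sup>2) * mu"

text \<open>What the two outlier terms still cost at the best size. The value \<open>y s\<close> has
  cancelled, so the outlier does not enter.\<close>

definition outlier_residual :: "real \<Rightarrow> nat \<Rightarrow> (nat \<Rightarrow> real) \<Rightarrow> real \<Rightarrow> real" where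
  "outlier_residual mu s y a = (y (s + 1) - a\<^sup>2 * y (s - 1) - (1 + a) * mu)\<^sup>2 / (1 + a\<^sup>2)"

text \<open>Pythagoras in the plane: with \<open>A\<close> and \<open>B\<close> as below, the left
  side is the squared distance from \<open>(A, B)\<close> to \<open>t\<close> times
  \<open>(1, - a)\<close>. The fit is the projection coefficient, and the residual comes from the
  component along the orthogonal vector \<open>(a, 1)\<close>.\<close>

lemma outlier_terms_eq:
  "(y s - a * y (s - 1) - mu - t)\<^sup>2 + (y (s + 1) - a * y s - mu + a * t)\<^sup>2
     = outlier_residual mu s y a + (1 + a\<^sup>2) * (t - outlier_size_fit mu s y a)\<^sup>2"
proof -
  have nz: "1 + a\<^sup>2 > 0" using zero_le_power2[of a] by linarith
  define d where "d = 1 + a\<^sup>2"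
  define A B where "A = y s - a * y (s - 1) - mu" and "B = y (s + 1) - a * y s - mu"
  have dz: "d \<noteq> 0" using nz by (simp add: d_def)
  have fit: "outlier_size_fit mu s y a = (A - a * B) / d"
    using dz unfolding outlier_size_fit_def A_def B_def d_def
    by (simp add: divide_simps) (simp add: algebra_simps power2_eq_square)
  have res: "outlier_residual mu s y a = (a * A + B)\<^sup>2 / d"
    unfolding outlier_residual_def A_def B_def d_def
    by (simp add: algebra_simps power2_eq_square)
  have "(a * A + B)\<^sup>2 / d + d * (t - (A - a * B) / d)\<^sup>2
      = ((a * A + B)\<^sup>2 + (d * t - (A - a * B))\<^sup>2) / d"
    using dz by (simp add: divide_simps power2_eq_square) (simp add: algebra_simps)
  also have "(a * A + B)\<^sup>2 + (d * t - (A - a * B))\<^sup>2 = d * ((A - t)\<^sup>2 + (B + a * t)\<^sup>2)"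
    by (simp add: d_def algebra_simps power2_eq_square)
  finally show ?thesis using dz by (simp add: fit res A_def B_def d_def)
qed

text \<open>Polynomial division by \<open>1 + a\<^sup>2\<close> leaves a quadratic polynomial plus a
  fraction with affine numerator, to which \<open>ex_convex_add_square\<close> applies.\<close>

lemma outlier_residual_semiconvex: "\<exists>K. convex_on UNIV (\<lambda>a. K * a\<^sup>2 + outlier_residual mu s y a)"
proof -
  \<comment> \<open>Writing \<open>a\<^sup>2\<close> as \<open>(1 + a\<^sup>2) - 1\<close> turns the
    squared numerator into an affine function \<open>e - mu * a\<close> minus a multiple of the
    denominator. The leading term \<open>b\<^sup>2 * a\<^sup>2\<close> of the quotient is absorbed
    by lowering \<open>K\<close> to \<open>K - b\<^sup>2\<close>.\<close>
  define e b where "e = y (s + 1) - mu + y (s - 1)" and "b = y (s - 1)"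
  obtain K where K: "convex_on UNIV (\<lambda>a. K * a\<^sup>2 + (e\<^sup>2 - mu\<^sup>2 + (- 2 * e * mu) * a) / (1 + a\<^sup>2))"
    using ex_convex_add_square by blast
  have aff: "convex_on UNIV (\<lambda>a. u + v * a)" for u v :: real
    by (rule f''_ge0_imp_convex[where f'="\<lambda>_. v" and f''="\<lambda>_. 0"]) (auto intro!: derivative_eq_intros)
  have "K * a\<^sup>2 + (e\<^sup>2 - mu\<^sup>2 + (- 2 * e * mu) * a) / (1 + a\<^sup>2)
        + ((b\<^sup>2 - 2 * b * e + mu\<^sup>2) + (2 * b * mu) * a)
      = (K - b\<^sup>2) * a\<^sup>2 + outlier_residual mu s y a" for a
  proof -
    have nz: "1 + a\<^sup>2 \<noteq> 0" using zero_le_power2[of a] by linarith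
    have "(y (s + 1) - a\<^sup>2 * y (s - 1) - (1 + a) * mu) = (e - mu * a) - b * (1 + a\<^sup>2)"
      by (simp add: e_def b_def algebra_simps)
    then have "outlier_residual mu s y a = ((e - mu * a) - b * (1 + a\<^sup>2))\<^sup>2 / (1 + a\<^sup>2)"
      by (simp add: outlier_residual_def)
    also have "((e - mu * a) - b * (1 + a\<^sup>2))\<^sup>2 = (e\<^sup>2 - mu\<^sup>2 + (- 2 * e * mu) * a)
        + (mu\<^sup>2 - 2 * b * (e - mu * a) + b\<^sup>2 * (1 + a\<^sup>2)) * (1 + a\<^sup>2)"
      by (simp add: algebra_simps power2_eq_square)
    also have "\<dots> / (1 + a\<^sup>2) = (e\<^sup>2 - mu\<^sup>2 + (- 2 * e * mu) * a) / (1 + a\<^sup>2)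
        + (mu\<^sup>2 - 2 * b * (e - mu * a) + b\<^sup>2 * (1 + a\<^sup>2))"
      using nz by (subst add_divide_distrib) simp
    finally show ?thesis by (simp only:) (simp add: algebra_simps)
  qed
  moreover have "convex_on UNIV (\<lambda>a. K * a\<^sup>2 + (e\<^sup>2 - mu\<^sup>2 + (- 2 * e * mu) * a) / (1 + a\<^sup>2)
        + ((b\<^sup>2 - 2 * b * e + mu\<^sup>2) + (2 * b * mu) * a))"
    by (intro convex_on_add K aff)
  ultimately have "convex_on UNIV (\<lambda>a. (K - b\<^sup>2) * a\<^sup>2 + outlier_residual mu s y a)" by simp
  then show ?thesis by blast
qed

lemma outlier_residual_nonneg: "outlier_residual mu s y a \<ge> 0"
  by (simp add: outlier_residual_def)

lemma continuous_on_outlier_residual: "continuous_on S (outlier_residual mu s y)"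
  unfolding outlier_residual_def
  by (intro continuous_intros) (metis add_pos_nonneg less_numeral_extra(3) zero_le_power2 zero_less_one)

text \<open>The pathwise half of the theorem: both hypotheses concern a single sequence
  \<open>y\<close>, and no probability enters.\<close>

lemma argmin_Qn_consistent:
  fixes y :: "nat \<Rightarrow> real" and mu \<alpha> :: real and s :: nat
  defines "I \<equiv> \<lambda>n. {1..n} - {s, s + 1}"
  defines "D \<equiv> \<lambda>n. \<Sum>k\<in>I n. (y (k - 1))\<^sup>2"
  assumes D: "filterlim D at_top sequentially"
    and r: "(\<lambda>n. (\<Sum>k\<in>I n. y (k - 1) * (y k - \<alpha> * y (k - 1) - mu)) / D n) \<longlonglongrightarrow> 0"
  shows "\<exists>n0. \<forall>n\<ge>n0. \<exists>!p. is_min_Qn mu s n y p" (is ?ex)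
    and "(\<lambda>n. fst (argmin_Qn mu s n y)) \<longlonglongrightarrow> \<alpha>" (is ?fst)
    and "(\<lambda>n. snd (argmin_Qn mu s n y)) \<longlonglongrightarrow> outlier_size_fit mu s y \<alpha>" (is ?snd)
proof -
  let ?g = "outlier_residual mu s y" and ?t = "outlier_size_fit mu s y"
  define e where "e n = (\<Sum>k\<in>I n. y (k - 1) * (y k - \<alpha> * y (k - 1) - mu)) / D n" for n
  define \<rho> where "\<rho> n = \<alpha> + e n" for n
  \<comment> \<open>Completing the square around the least squares estimate \<open>\<rho> n\<close>
    leaves this remainder, which depends on neither argument of the criterion.\<close>
  define c where "c n = (\<Sum>k\<in>I n. (y k - \<alpha> * y (k - 1) - mu)\<^sup>2) - D n * (e n)\<^sup>2" for n
  have Q: "Qn mu s n y a t = c n + (D n * (a - \<rho> n)\<^sup>2 + ?g a) + (1 + a\<^sup>2) * (t - ?t a)\<^sup>2"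
    if "D n \<ge> 1" for n a t
  proof -
    let ?m = "\<lambda>k. y k - \<alpha> * y (k - 1) - mu"
    have "(y k - a * y (k - 1) - mu)\<^sup>2 = (?m k)\<^sup>2 - 2 * (a - \<alpha>) * (y (k - 1) * ?m k)
        + (a - \<alpha>)\<^sup>2 * (y (k - 1))\<^sup>2" for k
      by (simp add: power2_eq_square algebra_simps)
    then have "(\<Sum>k\<in>I n. (y k - a * y (k - 1) - mu)\<^sup>2) = (\<Sum>k\<in>I n. (?m k)\<^sup>2)
        - 2 * (a - \<alpha>) * (\<Sum>k\<in>I n. y (k - 1) * ?m k) + (a - \<alpha>)\<^sup>2 * D n"
      by (simp add: D_def sum.distrib sum_subtractf sum_distrib_left)
    also have "(\<Sum>k\<in>I n. y (k - 1) * ?m k) = e n * D n" using that by (simp add: e_def)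
    finally have "(\<Sum>k\<in>I n. (y k - a * y (k - 1) - mu)\<^sup>2) = c n + D n * (a - \<rho> n)\<^sup>2"
      by (simp add: c_def \<rho>_def power2_eq_square algebra_simps)
    then show ?thesis
      using outlier_terms_eq[of y s a mu t] by (simp add: Qn_def I_def)
  qed
  obtain K where K: "convex_on UNIV (\<lambda>a. K * a\<^sup>2 + ?g a)" using outlier_residual_semiconvex by blast
  \<comment> \<open>The description is meaningful only once \<open>D n\<close> exceeds
    \<open>K\<close> and reaches 1; for earlier \<open>n\<close> the value is arbitrary, which does
    not affect limits.\<close>
  define a where "a n = (THE a. \<forall>b. D n * (a - \<rho> n)\<^sup>2 + ?g a \<le> D n * (b - \<rho> n)\<^sup>2 + ?g b)" for n
  have amin: "D n * (a n - \<rho> n)\<^sup>2 + ?g (a n) \<le> D n * (b - \<rho> n)\<^sup>2 + ?g b"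
    and aunique: "(\<And>b. D n * (a' - \<rho> n)\<^sup>2 + ?g a' \<le> D n * (b - \<rho> n)\<^sup>2 + ?g b) \<Longrightarrow> a' = a n"
    if "D n > K" "D n \<ge> 1" for n a' b
  proof -
    note ex1 = ex1_minimizer_square_plus_semiconvex[OF continuous_on_outlier_residual
        outlier_residual_nonneg K that, where r="\<rho> n"]
    show "D n * (a n - \<rho> n)\<^sup>2 + ?g (a n) \<le> D n * (b - \<rho> n)\<^sup>2 + ?g b"
      using theI'[OF ex1] unfolding a_def by blast
    show "a' = a n" if "\<And>b. D n * (a' - \<rho> n)\<^sup>2 + ?g a' \<le> D n * (b - \<rho> n)\<^sup>2 + ?g b"
      using the1_equality[OF ex1, of a'] that unfolding a_def by simp
  qed
  have min_iff: "is_min_Qn mu s n y p \<longleftrightarrow> p = (a n, ?t (a n))" if Dn: "D n > K" "D n \<ge> 1" for n p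
  proof
    assume p: "is_min_Qn mu s n y p"
    have le: "Qn mu s n y (fst p) (snd p) \<le> Qn mu s n y b t" for b t
      using p unfolding is_min_Qn_def by (metis fst_conv snd_conv)
    have pos: "1 + (fst p)\<^sup>2 > 0" using zero_le_power2[of "fst p"] by linarith
    \<comment> \<open>Comparison with the best size at the same slope forces the penalty to vanish;
      the slope can then be treated separately.\<close>
    have "(1 + (fst p)\<^sup>2) * (snd p - ?t (fst p))\<^sup>2 \<le> 0"
      using le[of "fst p" "?t (fst p)"] by (simp add: Q[OF Dn(2)])
    then have snd: "snd p = ?t (fst p)" using pos by (simp add: mult_le_0_iff)
    have "fst p = a n"
    proof (rule aunique[OF Dn])
      show "D n * (fst p - \<rho> n)\<^sup>2 + ?g (fst p) \<le> D n * (b - \<rho> n)\<^sup>2 + ?g b" for b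
        using le[of b "?t b"] snd by (simp add: Q[OF Dn(2)])
    qed
    then show "p = (a n, ?t (a n))" using snd by (simp add: prod_eq_iff)
  next
    assume "p = (a n, ?t (a n))"
    moreover have "D n * (a n - \<rho> n)\<^sup>2 + ?g (a n) \<le> D n * (b - \<rho> n)\<^sup>2 + ?g b + (1 + b\<^sup>2) * (t - ?t b)\<^sup>2"
      for b t using amin[OF Dn, of b] by (simp add: add_increasing2)
    ultimately show "is_min_Qn mu s n y p" by (simp add: is_min_Qn_def Q[OF Dn(2)] algebra_simps)
  qed
  have ev: "eventually (\<lambda>n. D n > K \<and> D n \<ge> 1) sequentially"
    using eventually_gt_at_top[of "max K 1"] filterlim_iff[THEN iffD1, OF D]
    by (auto elim!: eventually_mono dest!: spec[of _ "\<lambda>x. x > max K 1"])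
  have "eventually (\<lambda>n. \<exists>!p. is_min_Qn mu s n y p) sequentially"
    using ev by eventually_elim (simp add: min_iff)
  then show ?ex by (simp add: eventually_sequentially)
  have argmin: "eventually (\<lambda>n. (a n, ?t (a n)) = argmin_Qn mu s n y) sequentially"
    using ev by eventually_elim (simp add: argmin_Qn_def min_iff)
  have \<rho>: "\<rho> \<longlonglongrightarrow> \<alpha>"
    using tendsto_add[OF tendsto_const[of \<alpha>] r] unfolding \<rho>_def e_def by simp
  have "isCont ?g \<alpha>"
    using continuous_on_outlier_residual[of UNIV] by (auto simp: continuous_on_eq_continuous_at)
  then have "(\<lambda>n. ?g (\<rho> n)) \<longlonglongrightarrow> ?g \<alpha>" using \<rho> by (rule isCont_tendsto_compose)
  then have "(\<lambda>n. sqrt (?g (\<rho> n) / D n)) \<longlonglongrightarrow> sqrt 0"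
    by (intro tendsto_real_sqrt real_tendsto_divide_at_top D)
  \<comment> \<open>Comparing the minimiser with \<open>\<rho> n\<close> bounds \<open>D n\<close>
    times the squared distance by the residual at \<open>\<rho> n\<close>, which converges while
    \<open>D n\<close> diverges.\<close>
  moreover have "eventually (\<lambda>n. norm (a n - \<rho> n) \<le> sqrt (?g (\<rho> n) / D n)) sequentially"
    using ev
  proof eventually_elim
    case (elim n)
    then have "D n * (a n - \<rho> n)\<^sup>2 \<le> ?g (\<rho> n)"
      using amin[of n "\<rho> n"] outlier_residual_nonneg[of mu s y "a n"] by simp
    then have "(a n - \<rho> n)\<^sup>2 \<le> ?g (\<rho> n) / D n" using elim by (simp add: field_simps)
    then show ?case using real_sqrt_le_mono by fastforce
  qed
  ultimately have "(\<lambda>n. a n - \<rho> n) \<longlonglongrightarrow> 0"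
    by (intro Lim_null_comparison[of "\<lambda>n. a n - \<rho> n" "\<lambda>n. sqrt (?g (\<rho> n) / D n)"]) auto
  from tendsto_add[OF this \<rho>] have a: "a \<longlonglongrightarrow> \<alpha>" by simp
  have nz: "1 + \<alpha>\<^sup>2 \<noteq> 0" using zero_le_power2[of \<alpha>] by linarith
  have "(\<lambda>n. ?t (a n)) \<longlonglongrightarrow> ?t \<alpha>"
    unfolding outlier_size_fit_def using nz by (intro tendsto_intros a)
  then show ?snd
    by (rule Lim_transform_eventually) (use argmin in eventually_elim, metis snd_conv)
  from a show ?fst
    by (rule Lim_transform_eventually) (use argmin in eventually_elim, metis fst_conv)
qed

section \<open>Square integrable martingales and independence\<close>

lemma integrable_mult_of_square_integrable:
  fixes f g :: "'a \<Rightarrow> real"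
  assumes [measurable]: "f \<in> borel_measurable M" "g \<in> borel_measurable M"
    and "integrable M (\<lambda>x. (f x)\<^sup>2)" "integrable M (\<lambda>x. (g x)\<^sup>2)"
  shows "integrable M (\<lambda>x. f x * g x)"
proof (rule Bochner_Integration.integrable_bound)
  show "integrable M (\<lambda>x. (f x)\<^sup>2 + (g x)\<^sup>2)" using assms by simp
  have "\<bar>a * b\<bar> \<le> \<bar>a\<^sup>2 + b\<^sup>2\<bar>" for a b :: real
  proof -
    have "2 * (\<bar>a\<bar> * \<bar>b\<bar>) \<le> a\<^sup>2 + b\<^sup>2"
      using zero_le_power2[of "\<bar>a\<bar> - \<bar>b\<bar>"] by (simp add: power2_eq_square algebra_simps)
    moreover have "0 \<le> \<bar>a\<bar> * \<bar>b\<bar>" by simp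
    ultimately show ?thesis unfolding abs_mult by linarith
  qed
  then show "AE x in M. norm (f x * g x) \<le> norm ((f x)\<^sup>2 + (g x)\<^sup>2)"
    unfolding real_norm_def by blast
qed simp

text \<open>Indexing: \<open>d n\<close> is the increment from time \<open>n\<close> to
  \<open>Suc n\<close>, hence known at \<open>Suc n\<close> and centred given
  \<open>F n\<close>.\<close>

locale square_integrable_martingale_differences = prob_space M
  for M :: "'a measure" and F :: "nat \<Rightarrow> 'a measure" and d :: "nat \<Rightarrow> 'a \<Rightarrow> real" +
  assumes subalg: "\<And>n. subalgebra M (F n)"
    and filtration: "\<And>n. subalgebra (F (Suc n)) (F n)"
    and adapted: "\<And>n. d n \<in> borel_measurable (F (Suc n))"
    and square_integrable: "\<And>n. integrable M (\<lambda>\<omega>. (d n \<omega>)\<^sup>2)"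
    and cond_exp_zero: "\<And>n. AE \<omega> in M. real_cond_exp M (F n) (d n) \<omega> = 0"
begin

lemma filtration_mono: "m \<le> n \<Longrightarrow> subalgebra (F n) (F m)"
proof (induction n rule: dec_induct)
  case base then show ?case by (simp add: subalgebra_def)
next
  case (step n) then show ?case using filtration[of n] by (auto simp: subalgebra_def)
qed

lemma measurable_F: "m \<le> n \<Longrightarrow> f \<in> borel_measurable (F m) \<Longrightarrow> f \<in> borel_measurable (F n)"
  using measurable_from_subalg[OF filtration_mono] by blast

lemma measurable_d: "d n \<in> borel_measurable M"
  using measurable_from_subalg[OF subalg adapted] .

lemma measurable_d_F: "m < n \<Longrightarrow> d m \<in> borel_measurable (F n)"
  using measurable_F[OF _ adapted] by (simp add: Suc_le_eq)

text \<open>A factor known at time \<open>n\<close> can be pulled into the conditional expectation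
  of \<open>d n\<close>, which is zero.\<close>

lemma orthogonal:
  assumes g: "g \<in> borel_measurable (F n)" and g2: "integrable M (\<lambda>\<omega>. (g \<omega>)\<^sup>2)"
  shows "integrable M (\<lambda>\<omega>. g \<omega> * d n \<omega>)" and "(\<integral>\<omega>. g \<omega> * d n \<omega> \<partial>M) = 0"
proof -
  have [measurable]: "g \<in> borel_measurable M" using measurable_from_subalg[OF subalg g] .
  note measurable_d[measurable]
  interpret finite_measure_subalgebra M "F n"
    by unfold_locales (rule subalg)
  show int: "integrable M (\<lambda>\<omega>. g \<omega> * d n \<omega>)"
    by (intro integrable_mult_of_square_integrable square_integrable g2) measurable
  have "(\<integral>\<omega>. g \<omega> * d n \<omega> \<partial>M) = (\<integral>\<omega>. g \<omega> * real_cond_exp M (F n) (d n) \<omega> \<partial>M)"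
    using real_cond_exp_intg(2)[OF int g] by simp
  also have "\<dots> = (\<integral>\<omega>. 0 \<partial>M)"
    using cond_exp_zero[of n] measurable_from_subalg[OF subalg borel_measurable_cond_exp, measurable]
    by (intro integral_cong_AE) (auto elim: eventually_mono)
  finally show "(\<integral>\<omega>. g \<omega> * d n \<omega> \<partial>M) = 0" by simp
qed

text \<open>The indicators \<open>B k\<close> stop the martingale when it
  first leaves the interval \<open>(- e, e)\<close>, which preserves the orthogonality of the increments.\<close>

lemma maximal_inequality:
  assumes e: "e > 0"
  shows "prob {\<omega> \<in> space M. \<exists>i\<le>n. e \<le> \<bar>\<Sum>l<i. d l \<omega>\<bar>} \<le> (\<Sum>k<n. \<integral>\<omega>. (d k \<omega>)\<^sup>2 \<partial>M) / e\<^sup>2"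
proof -
  note measurable_d[measurable]
  define T where "T i \<omega> = (\<Sum>l<i. d l \<omega>)" for i \<omega>
  define B :: "nat \<Rightarrow> 'a \<Rightarrow> real" where "B k \<omega> = (if \<forall>i\<in>{..k}. \<bar>T i \<omega>\<bar> < e then 1 else 0)" for k \<omega>
  define S where "S j \<omega> = (\<Sum>k<j. B k \<omega> * d k \<omega>)" for j \<omega>
  have T_F: "T i \<in> borel_measurable (F k)" if "i \<le> k" for i k
    unfolding T_def using that by (intro borel_measurable_sum measurable_d_F) auto
  have B_F: "B k \<in> borel_measurable (F k)" for k
  proof -
    have [measurable]: "T i \<in> borel_measurable (F k)" if "i \<in> {..k}" for i using T_F that by simp
    show ?thesis unfolding B_def by measurable
  qed
  have S_F: "S j \<in> borel_measurable (F j)" for j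
    unfolding S_def
    by (intro borel_measurable_sum borel_measurable_times measurable_d_F measurable_F[OF _ B_F]) auto
  have [measurable]: "B k \<in> borel_measurable M" "S k \<in> borel_measurable M" "T k \<in> borel_measurable M" for k
    using measurable_from_subalg[OF subalg B_F] measurable_from_subalg[OF subalg S_F]
      measurable_from_subalg[OF subalg T_F] by auto
  have B01: "0 \<le> B k \<omega>" "B k \<omega> \<le> 1" for k \<omega> by (auto simp: B_def)
  have Bd2: "integrable M (\<lambda>\<omega>. (B k \<omega> * d k \<omega>)\<^sup>2)" "(\<integral>\<omega>. (B k \<omega> * d k \<omega>)\<^sup>2 \<partial>M) \<le> (\<integral>\<omega>. (d k \<omega>)\<^sup>2 \<partial>M)" for k
  proof -
    have le: "(B k \<omega> * d k \<omega>)\<^sup>2 \<le> (d k \<omega>)\<^sup>2" for \<omega>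
      by (auto simp: B_def)
    show "integrable M (\<lambda>\<omega>. (B k \<omega> * d k \<omega>)\<^sup>2)"
      by (rule Bochner_Integration.integrable_bound[OF square_integrable[of k]]) (use le in auto)
    then show "(\<integral>\<omega>. (B k \<omega> * d k \<omega>)\<^sup>2 \<partial>M) \<le> (\<integral>\<omega>. (d k \<omega>)\<^sup>2 \<partial>M)"
      by (intro integral_mono square_integrable le)
  qed
  \<comment> \<open>\<open>S j\<close> and \<open>B j\<close> are both known at time
    \<open>j\<close>, so the cross term has mean zero and each step adds at most the second moment
    of \<open>d j\<close>.\<close>
  have S2: "integrable M (\<lambda>\<omega>. (S j \<omega>)\<^sup>2) \<and> (\<integral>\<omega>. (S j \<omega>)\<^sup>2 \<partial>M) \<le> (\<Sum>k<j. \<integral>\<omega>. (d k \<omega>)\<^sup>2 \<partial>M)" for j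
  proof (induction j)
    case 0 then show ?case by (simp add: S_def)
  next
    case (Suc j)
    have eq: "(S (Suc j) \<omega>)\<^sup>2 = (S j \<omega>)\<^sup>2 + 2 * ((S j \<omega> * B j \<omega>) * d j \<omega>) + (B j \<omega> * d j \<omega>)\<^sup>2" for \<omega>
      by (simp add: S_def power2_eq_square algebra_simps)
    have "integrable M (\<lambda>\<omega>. (S j \<omega> * B j \<omega>)\<^sup>2)"
      by (rule Bochner_Integration.integrable_bound[OF conjunct1[OF Suc.IH]]) (auto simp: B_def)
    note o = orthogonal[OF borel_measurable_times[OF S_F B_F] this]
    show ?case using o Suc.IH Bd2[of j] by (simp add: eq)
  qed
  \<comment> \<open>After the first exit \<open>S\<close> keeps the exit value. An event about the
    whole path thus becomes one about \<open>S n\<close> alone, to which Markov's inequality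
    applies.\<close>
  have stop: "(\<forall>i\<le>j. \<bar>T i \<omega>\<bar> < e) \<and> S j \<omega> = T j \<omega> \<or> (\<exists>i\<le>j. e \<le> \<bar>T i \<omega>\<bar>) \<and> e \<le> \<bar>S j \<omega>\<bar>" for j \<omega>
  proof (induction j)
    case 0 then show ?case using e by (auto simp: T_def S_def)
  next
    case (Suc j)
    then show ?case
    proof
      assume *: "(\<forall>i\<le>j. \<bar>T i \<omega>\<bar> < e) \<and> S j \<omega> = T j \<omega>"
      then have "S (Suc j) \<omega> = T (Suc j) \<omega>" by (simp add: S_def T_def B_def)
      then show ?thesis using * by (cases "\<bar>T (Suc j) \<omega>\<bar> < e") (auto simp: le_Suc_eq not_less)
    next
      assume *: "(\<exists>i\<le>j. e \<le> \<bar>T i \<omega>\<bar>) \<and> e \<le> \<bar>S j \<omega>\<bar>"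
      then have "B j \<omega> = 0" by (auto simp: B_def not_less intro!: bexI)
      then have "S (Suc j) \<omega> = S j \<omega>" by (simp add: S_def)
      then show ?thesis using * by (auto intro: le_SucI)
    qed
  qed
  have "prob {\<omega> \<in> space M. \<exists>i\<le>n. e \<le> \<bar>\<Sum>l<i. d l \<omega>\<bar>} \<le> prob {\<omega> \<in> space M. e\<^sup>2 \<le> (S n \<omega>)\<^sup>2}"
  proof (rule finite_measure_mono)
    show "{\<omega> \<in> space M. \<exists>i\<le>n. e \<le> \<bar>\<Sum>l<i. d l \<omega>\<bar>} \<subseteq> {\<omega> \<in> space M. e\<^sup>2 \<le> (S n \<omega>)\<^sup>2}"
    proof safe
      fix \<omega> i assume "i \<le> n" "e \<le> \<bar>\<Sum>l<i. d l \<omega>\<bar>"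
      then have "e \<le> \<bar>S n \<omega>\<bar>" using stop[of n \<omega>] by (fastforce simp: T_def)
      then show "e\<^sup>2 \<le> (S n \<omega>)\<^sup>2" using e by (simp add: abs_le_square_iff[symmetric])
    qed
  qed measurable
  also have "\<dots> \<le> (\<integral>\<omega>. (S n \<omega>)\<^sup>2 \<partial>M) / e\<^sup>2"
    using S2[of n] e by (intro integral_Markov_inequality_measure[where A="{}"]) auto
  also have "\<dots> \<le> (\<Sum>k<n. \<integral>\<omega>. (d k \<omega>)\<^sup>2 \<partial>M) / e\<^sup>2"
    using S2[of n] by (simp add: divide_right_mono)
  finally show ?thesis .
qed

text \<open>The finite-horizon events increase to this one and their bounds are uniform in the
  horizon.\<close>

lemma maximal_inequality_infinite:
  assumes e: "e > 0" and sum: "summable (\<lambda>k. \<integral>\<omega>. (d k \<omega>)\<^sup>2 \<partial>M)"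
  shows "prob {\<omega> \<in> space M. \<exists>i. e \<le> \<bar>\<Sum>l<i. d l \<omega>\<bar>} \<le> (\<Sum>k. \<integral>\<omega>. (d k \<omega>)\<^sup>2 \<partial>M) / e\<^sup>2"
proof -
  note measurable_d[measurable]
  define A where "A n = {\<omega> \<in> space M. \<exists>i\<in>{..n}. e \<le> \<bar>\<Sum>l<i. d l \<omega>\<bar>}" for n
  have "range A \<subseteq> events" unfolding A_def by auto
  moreover have "incseq A" by (fastforce simp: incseq_def A_def)
  ultimately have "(\<lambda>n. prob (A n)) \<longlonglongrightarrow> prob (\<Union>n. A n)"
    by (rule finite_Lim_measure_incseq)
  moreover have "prob (A n) \<le> (\<Sum>k. \<integral>\<omega>. (d k \<omega>)\<^sup>2 \<partial>M) / e\<^sup>2" for n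
  proof -
    have "prob (A n) \<le> (\<Sum>k<n. \<integral>\<omega>. (d k \<omega>)\<^sup>2 \<partial>M) / e\<^sup>2"
      using maximal_inequality[OF e, of n] by (simp add: A_def atMost_def)
    also have "\<dots> \<le> (\<Sum>k. \<integral>\<omega>. (d k \<omega>)\<^sup>2 \<partial>M) / e\<^sup>2"
      using sum by (intro divide_right_mono sum_le_suminf) auto
    finally show ?thesis .
  qed
  ultimately have "prob (\<Union>n. A n) \<le> (\<Sum>k. \<integral>\<omega>. (d k \<omega>)\<^sup>2 \<partial>M) / e\<^sup>2"
    by (intro LIMSEQ_le_const2) auto
  moreover have "(\<Union>n. A n) = {\<omega> \<in> space M. \<exists>i. e \<le> \<bar>\<Sum>l<i. d l \<omega>\<bar>}"
    by (auto simp: A_def)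
  ultimately show ?thesis by simp
qed

lemma shift: "square_integrable_martingale_differences M (\<lambda>n. F (m + n)) (\<lambda>n. d (m + n))"
  using subalg filtration adapted square_integrable cond_exp_zero
  by unfold_locales auto

text \<open>The maximal inequality for the martingale restarted at \<open>m\<close> bounds the
  chance of a later fluctuation of size \<open>e\<close> by a tail of the variance series over
  \<open>e\<^sup>2\<close>. Letting \<open>m\<close> grow shows that almost every path has Cauchy
  partial sums.\<close>

lemma AE_summable:
  assumes sum: "summable (\<lambda>k. \<integral>\<omega>. (d k \<omega>)\<^sup>2 \<partial>M)"
  shows "AE \<omega> in M. summable (\<lambda>k. d k \<omega>)"
proof -
  note measurable_d[measurable]
  have "AE \<omega> in M. \<exists>m. \<forall>i. \<bar>\<Sum>l<i. d (m + l) \<omega>\<bar> < e" if e: "e > 0" for e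
  proof -
    define N where "N m = {\<omega> \<in> space M. \<exists>i. e \<le> \<bar>\<Sum>l<i. d (m + l) \<omega>\<bar>}" for m
    have [measurable]: "N m \<in> events" for m unfolding N_def by measurable
    have "prob (\<Inter>m. N m) \<le> (\<Sum>k. \<integral>\<omega>. (d (k + m) \<omega>)\<^sup>2 \<partial>M) / e\<^sup>2" for m
    proof -
      interpret sh: square_integrable_martingale_differences M "\<lambda>n. F (m + n)" "\<lambda>n. d (m + n)"
        by (rule shift)
      have "summable (\<lambda>k. \<integral>\<omega>. (d (m + k) \<omega>)\<^sup>2 \<partial>M)"
        using summable_ignore_initial_segment[OF sum, of m] by (simp add: add.commute)
      from sh.maximal_inequality_infinite[OF e this]
      have "prob (N m) \<le> (\<Sum>k. \<integral>\<omega>. (d (k + m) \<omega>)\<^sup>2 \<partial>M) / e\<^sup>2"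
        by (simp add: N_def add.commute)
      moreover have "prob (\<Inter>m. N m) \<le> prob (N m)" by (intro finite_measure_mono) auto
      ultimately show ?thesis by simp
    qed
    moreover have "(\<lambda>m. (\<Sum>k. \<integral>\<omega>. (d (k + m) \<omega>)\<^sup>2 \<partial>M) / e\<^sup>2) \<longlonglongrightarrow> 0 / e\<^sup>2"
      using e by (intro tendsto_divide suminf_exist_split2[OF sum]) auto
    ultimately have "prob (\<Inter>m. N m) \<le> 0" by (intro LIMSEQ_le_const) auto
    then have "prob (\<Inter>m. N m) = 0" using measure_nonneg[of M "\<Inter>m. N m"] by linarith
    then have "AE \<omega> in M. \<omega> \<notin> (\<Inter>m. N m)" by (simp add: prob_eq_0)
    with AE_space show ?thesis by eventually_elim (auto simp: N_def not_le)
  qed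
  \<comment> \<open>Countably many thresholds suffice, so the exceptional null sets can be
    united.\<close>
  then have "AE \<omega> in M. \<forall>p. \<exists>m. \<forall>i. \<bar>\<Sum>l<i. d (m + l) \<omega>\<bar> < inverse (real (Suc p))"
    by (simp add: AE_all_countable)
  then show ?thesis
  proof eventually_elim
    case (elim \<omega>)
    have "Cauchy (\<lambda>n. \<Sum>k<n. d k \<omega>)"
    proof (rule CauchyI)
      fix e :: real assume "e > 0"
      then obtain p where p: "inverse (real (Suc p)) < e / 2" using reals_Archimedean[of "e / 2"] by auto
      obtain m where m: "\<And>i. \<bar>\<Sum>l<i. d (m + l) \<omega>\<bar> < inverse (real (Suc p))" using elim by blast
      have split: "(\<Sum>k<n. d k \<omega>) = (\<Sum>k<m. d k \<omega>) + (\<Sum>l<n - m. d (m + l) \<omega>)" if "n \<ge> m" for n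
        using that sum.atLeastLessThan_concat[of 0 m n "\<lambda>k. d k \<omega>"] sum.shift_bounds_nat_ivl[of "\<lambda>k. d k \<omega>" 0 m "n - m"]
        by (simp add: atLeast0LessThan add.commute)
      show "\<exists>m. \<forall>i\<ge>m. \<forall>j\<ge>m. norm ((\<Sum>k<i. d k \<omega>) - (\<Sum>k<j. d k \<omega>)) < e"
      proof (intro exI[of _ m] allI impI)
        fix i j assume "i \<ge> m" "j \<ge> m"
        then show "norm ((\<Sum>k<i. d k \<omega>) - (\<Sum>k<j. d k \<omega>)) < e"
          using m[of "i - m"] m[of "j - m"] p unfolding split[OF \<open>i \<ge> m\<close>] split[OF \<open>j \<ge> m\<close>] real_norm_def
          by linarith
      qed
    qed
    then show ?case by (simp add: summable_iff_convergent Cauchy_convergent_iff)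
  qed
qed

end

section \<open>Integration over independent pairs and sums\<close>

text \<open>Tonelli for the product law; \<open>\<omega>'\<close> acts as an independent copy. The
  nonnegative version needs no prior integrability, so it can later establish that the second
  moments are finite.\<close>

lemma (in prob_space) nn_integral_indep_var:
  assumes ind: "indep_var S X T Y" and h[measurable]: "h \<in> borel_measurable (S \<Otimes>\<^sub>M T)"
  shows "(\<integral>\<^sup>+\<omega>. h (X \<omega>, Y \<omega>) \<partial>M) = (\<integral>\<^sup>+\<omega>. \<integral>\<^sup>+\<omega>'. h (X \<omega>, Y \<omega>') \<partial>M \<partial>M)"
proof -
  have [measurable]: "random_variable S X" "random_variable T Y"
    and eq: "distr M S X \<Otimes>\<^sub>M distr M T Y = distr M (S \<Otimes>\<^sub>M T) (\<lambda>x. (X x, Y x))"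
    using ind by (auto simp: indep_var_distribution_eq)
  interpret Y: prob_space "distr M T Y" by (rule prob_space_distr) measurable
  have "(\<integral>\<^sup>+\<omega>. h (X \<omega>, Y \<omega>) \<partial>M) = (\<integral>\<^sup>+z. h z \<partial>(distr M S X \<Otimes>\<^sub>M distr M T Y))"
    unfolding eq by (simp add: nn_integral_distr)
  also have "\<dots> = (\<integral>\<^sup>+x. \<integral>\<^sup>+y. h (x, y) \<partial>distr M T Y \<partial>distr M S X)"
    by (rule Y.nn_integral_fst[symmetric]) measurable
  also have "\<dots> = (\<integral>\<^sup>+\<omega>. \<integral>\<^sup>+y. h (X \<omega>, y) \<partial>distr M T Y \<partial>M)"
    by (rule nn_integral_distr) measurable
  also have "\<dots> = (\<integral>\<^sup>+\<omega>. \<integral>\<^sup>+\<omega>'. h (X \<omega>, Y \<omega>') \<partial>M \<partial>M)"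
    by (intro nn_integral_cong nn_integral_distr) (measurable, auto intro: measurable_space)
  finally show ?thesis .
qed

text \<open>Fubini: with the first component frozen, the integral over the second already
  vanishes.\<close>

lemma (in prob_space) integral_indep_var_eq_0:
  fixes h :: "'b \<times> 'b \<Rightarrow> real"
  assumes ind: "indep_var S X T Y" and h[measurable]: "h \<in> borel_measurable (S \<Otimes>\<^sub>M T)"
    and int: "integrable M (\<lambda>\<omega>. h (X \<omega>, Y \<omega>))"
    and zero: "\<And>x. x \<in> space S \<Longrightarrow> (\<integral>\<omega>. h (x, Y \<omega>) \<partial>M) = 0"
  shows "(\<integral>\<omega>. h (X \<omega>, Y \<omega>) \<partial>M) = 0"
proof -
  have [measurable]: "random_variable S X" "random_variable T Y"
    and eq: "distr M S X \<Otimes>\<^sub>M distr M T Y = distr M (S \<Otimes>\<^sub>M T) (\<lambda>x. (X x, Y x))"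
    using ind by (auto simp: indep_var_distribution_eq)
  interpret X: prob_space "distr M S X" by (rule prob_space_distr) measurable
  interpret Y: prob_space "distr M T Y" by (rule prob_space_distr) measurable
  interpret P: pair_sigma_finite "distr M S X" "distr M T Y" ..
  have int': "integrable (distr M S X \<Otimes>\<^sub>M distr M T Y) h"
    unfolding eq using int by (subst integrable_distr_eq) auto
  have "(\<integral>\<omega>. h (X \<omega>, Y \<omega>) \<partial>M) = (\<integral>z. h z \<partial>(distr M S X \<Otimes>\<^sub>M distr M T Y))"
    unfolding eq by (simp add: integral_distr)
  also have "\<dots> = (\<integral>x. \<integral>y. h (x, y) \<partial>distr M T Y \<partial>distr M S X)"
    by (rule P.integral_fst'[symmetric, OF int'])
  also have "\<dots> = (\<integral>x. 0 \<partial>distr M S X)"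
  proof (rule Bochner_Integration.integral_cong[OF refl])
    fix x assume "x \<in> space (distr M S X)"
    then have x: "x \<in> space S" by simp
    then have "(\<lambda>y. h (x, y)) \<in> borel_measurable T" by measurable
    then show "(\<integral>y. h (x, y) \<partial>distr M T Y) = 0"
      using zero[OF x] by (simp add: integral_distr)
  qed
  finally show ?thesis by simp
qed

text \<open>A new summand is independent of the sum of the others and both are integrable, so the
  cross term has the product of the means, zero, as its mean.\<close>

lemma (in prob_space) square_sum_indep_centered:
  fixes U :: "'i \<Rightarrow> 'a \<Rightarrow> real"
  assumes "finite I" and "indep_vars (\<lambda>_. borel) U I"
    and "\<And>i. i \<in> I \<Longrightarrow> integrable M (\<lambda>\<omega>. (U i \<omega>)\<^sup>2)"
    and "\<And>i. i \<in> I \<Longrightarrow> integrable M (U i)"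
    and "\<And>i. i \<in> I \<Longrightarrow> expectation (U i) = 0"
  shows "integrable M (\<lambda>\<omega>. (\<Sum>i\<in>I. U i \<omega>)\<^sup>2)"
    and "expectation (\<lambda>\<omega>. (\<Sum>i\<in>I. U i \<omega>)\<^sup>2) = (\<Sum>i\<in>I. expectation (\<lambda>\<omega>. (U i \<omega>)\<^sup>2))"
  using assms
proof (induction I rule: finite_induct)
  case empty
  { case 1 then show ?case by simp }
  { case 2 then show ?case by simp }
next
  case (insert i I)
  have eq: "(\<Sum>i\<in>insert i I. U i \<omega>)\<^sup>2 = (U i \<omega>)\<^sup>2 + 2 * (U i \<omega> * (\<Sum>i\<in>I. U i \<omega>)) + (\<Sum>i\<in>I. U i \<omega>)\<^sup>2" for \<omega>
    using insert.hyps by (simp add: power2_eq_square algebra_simps)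
  {
    assume indep: "indep_vars (\<lambda>_. borel) U (insert i I)"
      and sq: "\<And>j. j \<in> insert i I \<Longrightarrow> integrable M (\<lambda>\<omega>. (U j \<omega>)\<^sup>2)"
      and int: "\<And>j. j \<in> insert i I \<Longrightarrow> integrable M (U j)"
      and zero: "\<And>j. j \<in> insert i I \<Longrightarrow> expectation (U j) = 0"
    have IH1: "integrable M (\<lambda>\<omega>. (\<Sum>i\<in>I. U i \<omega>)\<^sup>2)"
      using indep_vars_subset[OF indep, of I] sq int zero by (intro insert.IH(1)) auto
    have IH2: "expectation (\<lambda>\<omega>. (\<Sum>i\<in>I. U i \<omega>)\<^sup>2) = (\<Sum>i\<in>I. expectation (\<lambda>\<omega>. (U i \<omega>)\<^sup>2))"
      using indep_vars_subset[OF indep, of I] sq int zero by (intro insert.IH(2)) auto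
    have ind: "indep_var borel (U i) borel (\<lambda>\<omega>. \<Sum>i\<in>I. U i \<omega>)"
      using insert.hyps indep by (intro indep_vars_sum) auto
    have intS: "integrable M (\<lambda>\<omega>. \<Sum>i\<in>I. U i \<omega>)" using int by auto
    have prod: "integrable M (\<lambda>\<omega>. U i \<omega> * (\<Sum>i\<in>I. U i \<omega>))"
      by (rule indep_var_integrable[OF ind int[OF insertI1] intS])
    have prod0: "expectation (\<lambda>\<omega>. U i \<omega> * (\<Sum>i\<in>I. U i \<omega>)) = 0"
      using indep_var_lebesgue_integral[OF ind int[OF insertI1] intS] zero by simp
    have "integrable M (\<lambda>\<omega>. (\<Sum>i\<in>insert i I. U i \<omega>)\<^sup>2)
      \<and> expectation (\<lambda>\<omega>. (\<Sum>i\<in>insert i I. U i \<omega>)\<^sup>2)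
          = (\<Sum>i\<in>insert i I. expectation (\<lambda>\<omega>. (U i \<omega>)\<^sup>2))"
      unfolding eq using sq[of i] IH1 IH2 prod prod0 insert.hyps by simp
  } note * = this
  { case 1 then show ?case using * by blast }
  { case 2 then show ?case using * by blast }
qed

section \<open>The INAR(1) process\<close>

locale inar_process = prob_space M
  for M :: "'w measure" and Z :: "inar_idx \<Rightarrow> 'w \<Rightarrow> nat" and \<alpha> :: real +
  assumes meas: "\<And>i. i \<in> inar_index \<Longrightarrow> Z i \<in> measurable M (count_space UNIV)"
    and indep: "indep_vars (\<lambda>_. count_space UNIV) Z inar_index"
    and eps_id: "\<And>k. k \<ge> 1 \<Longrightarrow>
        distr M (count_space UNIV) (Z (IEps k)) = distr M (count_space UNIV) (Z (IEps 1))"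
    and eps_sq: "integrable M (\<lambda>\<omega>. (real (Z (IEps 1) \<omega>))\<^sup>2)"
    and eps_nz: "prob {\<omega> \<in> space M. Z (IEps 1) \<omega> \<noteq> 0} > 0"
    and xi_bern: "\<And>k j \<omega>. k \<ge> 1 \<Longrightarrow> j \<ge> 1 \<Longrightarrow> \<omega> \<in> space M \<Longrightarrow> Z (IXi k j) \<omega> \<le> 1"
    and xi_mean: "\<And>k j. k \<ge> 1 \<Longrightarrow> j \<ge> 1 \<Longrightarrow> prob {\<omega> \<in> space M. Z (IXi k j) \<omega> = 1} = \<alpha>"
begin

definition mu :: real where "mu = expectation (\<lambda>\<omega>. real (Z (IEps 1) \<omega>))"

section \<open>Trajectories as functions of the primitive variables\<close>

definition past :: "nat \<Rightarrow> inar_idx set" where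
  "past k = {IX0} \<union> {IEps i | i. 1 \<le> i \<and> i \<le> k} \<union> {IXi i j | i j. 1 \<le> i \<and> i \<le> k \<and> 1 \<le> j}"

text \<open>All counting variables of the generation are included, although only a random number of
  them is used: independence needs index sets fixed in advance.\<close>

definition innov_idx :: "nat \<Rightarrow> inar_idx set" where
  "innov_idx k = {IEps k} \<union> {IXi k j | j. 1 \<le> j}"

text \<open>Taking a point \<open>z\<close> of the product space instead of a sample point allows
  evaluation on restrictions to \<open>past k\<close>.\<close>

definition traj :: "(inar_idx \<Rightarrow> nat) \<Rightarrow> nat \<Rightarrow> nat" where
  "traj z = inar (z IX0) (\<lambda>k. z (IEps k)) (\<lambda>k j. z (IXi k j))"

abbreviation X :: "nat \<Rightarrow> 'w \<Rightarrow> nat" where "X k \<omega> \<equiv> traj (\<lambda>i. Z i \<omega>) k"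

definition used_idx :: "nat \<Rightarrow> nat \<Rightarrow> inar_idx set" where
  "used_idx k x = insert (IEps k) (IXi k ` {1..x})"

text \<open>The population size \<open>x\<close> is a separate argument so that it can be frozen
  while the fresh variables are integrated. With \<open>x = traj z k\<close> this is the martingale
  increment of the process, see \<open>innov_traj\<close>.\<close>

definition innov :: "nat \<Rightarrow> nat \<Rightarrow> (inar_idx \<Rightarrow> nat) \<Rightarrow> real" where
  "innov k x z = (\<Sum>i\<in>used_idx k x. real (z i) - expectation (\<lambda>\<omega>. real (Z i \<omega>)))"

lemma past_subset: "past k \<subseteq> inar_index" "innov_idx (Suc k) \<subseteq> inar_index"
  by (auto simp: past_def innov_idx_def inar_index_def)

lemma used_idx_subset: "used_idx k x \<subseteq> innov_idx k" and finite_used_idx: "finite (used_idx k x)"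
  by (auto simp: used_idx_def innov_idx_def)

lemma traj_Suc: "traj z (Suc k) = (\<Sum>j=1..traj z k. z (IXi (Suc k) j)) + z (IEps (Suc k))"
  by (simp add: traj_def)

lemma traj_cong: "(\<And>i. i \<in> past k \<Longrightarrow> z i = z' i) \<Longrightarrow> traj z k = traj z' k"
proof (induction k)
  case 0 then show ?case by (simp add: traj_def past_def)
next
  case (Suc k)
  have "traj z k = traj z' k" by (rule Suc.IH) (rule Suc.prems, auto simp: past_def)
  then show ?case unfolding traj_Suc using Suc.prems by (auto simp: past_def)
qed

lemma traj_restrict: "past k \<subseteq> J \<Longrightarrow> traj (restrict z J) k = traj z k"
  by (rule traj_cong) auto

lemma past_mono: "k \<le> l \<Longrightarrow> past k \<subseteq> past l"
  by (auto simp: past_def)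

lemma measurable_traj [measurable (raw)]:
  assumes "\<And>i. i \<in> past k \<Longrightarrow> (\<lambda>x. z x i) \<in> measurable N (count_space UNIV)"
  shows "(\<lambda>x. traj (z x) k) \<in> measurable N (count_space UNIV)"
  using assms
proof (induction k)
  case 0 then show ?case by (simp add: traj_def past_def)
next
  case (Suc k)
  have [measurable]: "(\<lambda>x. traj (z x) k) \<in> measurable N (count_space UNIV)"
    by (rule Suc.IH) (rule Suc.prems, auto simp: past_def)
  have [measurable]: "(\<lambda>x. z x (IEps (Suc k))) \<in> measurable N (count_space UNIV)"
    "\<And>j. 1 \<le> j \<Longrightarrow> (\<lambda>x. z x (IXi (Suc k) j)) \<in> measurable N (count_space UNIV)"
    by (auto intro: Suc.prems simp: past_def)
  \<comment> \<open>The number of summands is itself random: measurability is shown for each fixed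
    \<open>n\<close> and then composed with the countably valued population size.\<close>
  have "(\<lambda>x. \<Sum>j=1..n. z x (IXi (Suc k) j)) \<in> measurable N (count_space UNIV)" for n
    by measurable
  then have [measurable]: "(\<lambda>x. \<Sum>j=1..traj (z x) k. z x (IXi (Suc k) j)) \<in> measurable N (count_space UNIV)"
    by (rule measurable_compose_countable) measurable
  show ?case unfolding traj_Suc by measurable
qed

lemma measurable_X [measurable]: "X k \<in> measurable M (count_space UNIV)"
  using past_subset by (intro measurable_traj meas) auto

section \<open>Moments of the innovations\<close>

lemma eps_moments:
  fixes f :: "nat \<Rightarrow> real"
  assumes k: "k \<ge> 1"
  shows "expectation (\<lambda>\<omega>. f (Z (IEps k) \<omega>)) = expectation (\<lambda>\<omega>. f (Z (IEps 1) \<omega>))"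
    and "integrable M (\<lambda>\<omega>. f (Z (IEps k) \<omega>)) \<longleftrightarrow> integrable M (\<lambda>\<omega>. f (Z (IEps 1) \<omega>))"
proof -
  have [measurable]: "Z (IEps j) \<in> measurable M (count_space UNIV)" if "j \<ge> 1" for j
    using that by (intro meas) (simp add: inar_index_def)
  note k[measurable]
  have "expectation (\<lambda>\<omega>. f (Z (IEps k) \<omega>)) = (\<integral>x. f x \<partial>distr M (count_space UNIV) (Z (IEps k)))"
    by (rule integral_distr[symmetric]) auto
  also have "\<dots> = expectation (\<lambda>\<omega>. f (Z (IEps 1) \<omega>))"
    unfolding eps_id[OF k] by (rule integral_distr) auto
  finally show "expectation (\<lambda>\<omega>. f (Z (IEps k) \<omega>)) = expectation (\<lambda>\<omega>. f (Z (IEps 1) \<omega>))" .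
  have "integrable M (\<lambda>\<omega>. f (Z (IEps k) \<omega>)) \<longleftrightarrow> integrable (distr M (count_space UNIV) (Z (IEps k))) f"
    by (rule integrable_distr_eq[symmetric]) auto
  also have "\<dots> \<longleftrightarrow> integrable M (\<lambda>\<omega>. f (Z (IEps 1) \<omega>))"
    unfolding eps_id[OF k] by (rule integrable_distr_eq) auto
  finally show "integrable M (\<lambda>\<omega>. f (Z (IEps k) \<omega>)) \<longleftrightarrow> integrable M (\<lambda>\<omega>. f (Z (IEps 1) \<omega>))" .
qed

lemma eps_expectation: "k \<ge> 1 \<Longrightarrow> expectation (\<lambda>\<omega>. real (Z (IEps k) \<omega>)) = mu"
  unfolding mu_def by (rule eps_moments)

lemma xi_expectation:
  assumes "k \<ge> 1" "j \<ge> 1"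
  shows "expectation (\<lambda>\<omega>. real (Z (IXi k j) \<omega>)) = \<alpha>"
proof -
  have [measurable]: "Z (IXi k j) \<in> measurable M (count_space UNIV)"
    using assms by (auto intro!: meas simp: inar_index_def)
  have "expectation (\<lambda>\<omega>. real (Z (IXi k j) \<omega>))
      = expectation (indicator {\<omega> \<in> space M. Z (IXi k j) \<omega> = 1})"
    using xi_bern[OF assms] by (intro Bochner_Integration.integral_cong) (auto simp: indicator_def le_Suc_eq)
  then show ?thesis using xi_mean[OF assms] by simp
qed

lemma innov_eq:
  "innov (Suc k) x z = (\<Sum>j=1..x. real (z (IXi (Suc k) j)) - \<alpha>) + (real (z (IEps (Suc k))) - mu)"
proof -
  have "innov (Suc k) x z = (real (z (IEps (Suc k))) - mu)
      + (\<Sum>i\<in>IXi (Suc k) ` {1..x}. real (z i) - expectation (\<lambda>\<omega>. real (Z i \<omega>)))"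
    unfolding innov_def used_idx_def by (subst sum.insert) (auto simp: eps_expectation)
  also have "(\<Sum>i\<in>IXi (Suc k) ` {1..x}. real (z i) - expectation (\<lambda>\<omega>. real (Z i \<omega>)))
      = (\<Sum>j=1..x. real (z (IXi (Suc k) j)) - \<alpha>)"
    by (subst sum.reindex) (auto simp: inj_on_def xi_expectation)
  finally show ?thesis by simp
qed

lemma innov_traj: "innov (Suc k) (traj z k) z = real (traj z (Suc k)) - \<alpha> * real (traj z k) - mu"
  unfolding innov_eq traj_Suc by (simp add: sum_subtractf)

lemma centered_moments:
  assumes i: "i \<in> innov_idx (Suc k)"
  defines "U \<equiv> \<lambda>\<omega>. real (Z i \<omega>) - expectation (\<lambda>\<omega>. real (Z i \<omega>))"
  shows "integrable M U" and "expectation U = 0" and "integrable M (\<lambda>\<omega>. (U \<omega>)\<^sup>2)"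
    and "expectation (\<lambda>\<omega>. (U \<omega>)\<^sup>2) \<le> (if i = IEps (Suc k)
      then expectation (\<lambda>\<omega>. (real (Z (IEps 1) \<omega>) - mu)\<^sup>2) else 1)"
proof -
  have [measurable]: "Z i \<in> measurable M (count_space UNIV)"
    using i past_subset(2)[of k] by (intro meas) auto
  have sq: "integrable M (\<lambda>\<omega>. (real (Z i \<omega>))\<^sup>2)"
  proof (cases "i = IEps (Suc k)")
    case True then show ?thesis
      using eps_moments(2)[of "Suc k" "\<lambda>n. (real n)\<^sup>2"] eps_sq by simp
  next
    case False
    then obtain j where "i = IXi (Suc k) j" "j \<ge> 1" using i by (auto simp: innov_idx_def)
    then have "AE \<omega> in M. norm ((real (Z i \<omega>))\<^sup>2) \<le> 1"
      using xi_bern[of "Suc k" j] by (intro AE_I2) (auto simp: power_le_one)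
    then show ?thesis by (intro integrable_const_bound[where B=1]) measurable
  qed
  then have int: "integrable M (\<lambda>\<omega>. real (Z i \<omega>))"
    by (rule square_integrable_imp_integrable[rotated]) measurable
  show "integrable M U" "expectation U = 0" unfolding U_def using int by (auto simp: prob_space)
  show U2: "integrable M (\<lambda>\<omega>. (U \<omega>)\<^sup>2)"
    unfolding U_def power2_diff using sq int by auto
  show "expectation (\<lambda>\<omega>. (U \<omega>)\<^sup>2) \<le> (if i = IEps (Suc k)
      then expectation (\<lambda>\<omega>. (real (Z (IEps 1) \<omega>) - mu)\<^sup>2) else 1)"
  proof (cases "i = IEps (Suc k)")
    case True then show ?thesis
      using eps_moments(1)[of "Suc k" "\<lambda>n. (real n - mu)\<^sup>2"] eps_expectation[of "Suc k"]
      by (simp add: U_def)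
  next
    case False
    then obtain j where j: "i = IXi (Suc k) j" "j \<ge> 1" using i by (auto simp: innov_idx_def)
    then have U: "U \<omega> = real (Z i \<omega>) - \<alpha>" for \<omega> by (simp add: U_def xi_expectation)
    \<comment> \<open>The locale states no range for \<alpha>; it lies in the unit interval because
      it is a probability.\<close>
    have \<alpha>: "0 \<le> \<alpha>" "\<alpha> \<le> 1" using xi_mean[of 1 1] prob_le_1 measure_nonneg by force+
    have "(U \<omega>)\<^sup>2 \<le> 1" if "\<omega> \<in> space M" for \<omega>
    proof -
      have "real (Z i \<omega>) \<le> 1" using xi_bern[OF _ j(2) that, of "Suc k"] j by simp
      then have "\<bar>U \<omega>\<bar> \<le> 1" unfolding U using \<alpha> by (simp add: abs_le_iff)
      then show ?thesis by (simp add: abs_square_le_1)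
    qed
    then have "expectation (\<lambda>\<omega>. (U \<omega>)\<^sup>2) \<le> expectation (\<lambda>\<omega>. 1)"
      by (intro integral_mono U2) auto
    then show ?thesis using False by (simp add: prob_space)
  qed
qed

text \<open>With V the variance of the innovations, the variance bound V + x is at most (1 + V)(x +
  1); the constant is 1 + V.\<close>

definition noise_bound :: real where "noise_bound = 1 + expectation (\<lambda>\<omega>. (real (Z (IEps 1) \<omega>) - mu)\<^sup>2)"

lemma noise_bound_ge_1: "noise_bound \<ge> 1"
  by (simp add: noise_bound_def)

text \<open>For frozen \<open>x\<close> the innovation is a sum of independent centred variables:
  one immigration term and \<open>x\<close> Bernoulli terms of variance at most 1.\<close>

lemma innov_moments:
  shows "integrable M (\<lambda>\<omega>. innov (Suc k) x (\<lambda>i. Z i \<omega>))"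
    and "expectation (\<lambda>\<omega>. innov (Suc k) x (\<lambda>i. Z i \<omega>)) = 0"
    and "integrable M (\<lambda>\<omega>. (innov (Suc k) x (\<lambda>i. Z i \<omega>))\<^sup>2)"
    and "expectation (\<lambda>\<omega>. (innov (Suc k) x (\<lambda>i. Z i \<omega>))\<^sup>2) \<le> noise_bound * (real x + 1)"
proof -
  define U where "U i \<omega> = real (Z i \<omega>) - expectation (\<lambda>\<omega>. real (Z i \<omega>))" for i \<omega>
  let ?I = "used_idx (Suc k) x"
  let ?V = "expectation (\<lambda>\<omega>. (real (Z (IEps 1) \<omega>) - mu)\<^sup>2)"
  have innov: "innov (Suc k) x (\<lambda>i. Z i \<omega>) = (\<Sum>i\<in>?I. U i \<omega>)" for \<omega>
    by (simp add: innov_def U_def)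
  have sub: "i \<in> innov_idx (Suc k)" if "i \<in> ?I" for i using that used_idx_subset by auto
  note mom = centered_moments[OF sub, folded U_def]
  show "integrable M (\<lambda>\<omega>. innov (Suc k) x (\<lambda>i. Z i \<omega>))"
    "expectation (\<lambda>\<omega>. innov (Suc k) x (\<lambda>i. Z i \<omega>)) = 0"
    unfolding innov using mom by auto
  have "indep_vars (\<lambda>_. count_space UNIV) Z ?I"
    using indep by (rule indep_vars_subset) (use sub past_subset in blast)
  then have ind: "indep_vars (\<lambda>_. borel) U ?I"
    unfolding U_def by (rule indep_vars_compose2) auto
  note sq = square_sum_indep_centered[OF finite_used_idx ind mom(3) mom(1) mom(2)]
  show "integrable M (\<lambda>\<omega>. (innov (Suc k) x (\<lambda>i. Z i \<omega>))\<^sup>2)"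
    unfolding innov by (rule sq(1))
  have "expectation (\<lambda>\<omega>. (innov (Suc k) x (\<lambda>i. Z i \<omega>))\<^sup>2) = (\<Sum>i\<in>?I. expectation (\<lambda>\<omega>. (U i \<omega>)\<^sup>2))"
    unfolding innov by (rule sq(2))
  also have "\<dots> \<le> (\<Sum>i\<in>?I. if i = IEps (Suc k) then ?V else 1)"
    by (intro sum_mono mom(4))
  also have "\<dots> = ?V + (\<Sum>i\<in>IXi (Suc k) ` {1..x}. 1)"
    unfolding used_idx_def by (subst sum.insert) (auto simp del: sum_constant intro!: sum.cong)
  also have "\<dots> = ?V + real x" by (simp add: card_image inj_on_def)
  also have "\<dots> \<le> noise_bound * (real x + 1)"
    by (simp add: noise_bound_def algebra_simps)
  finally show "expectation (\<lambda>\<omega>. (innov (Suc k) x (\<lambda>i. Z i \<omega>))\<^sup>2) \<le> noise_bound * (real x + 1)" .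
qed

lemma indep_past_innov:
  "indep_var (PiM (past k) (\<lambda>_. count_space UNIV)) (\<lambda>\<omega>. restrict (\<lambda>i. Z i \<omega>) (past k))
     (PiM (innov_idx (Suc k)) (\<lambda>_. count_space UNIV)) (\<lambda>\<omega>. restrict (\<lambda>i. Z i \<omega>) (innov_idx (Suc k)))"
proof -
  have "indep_vars (\<lambda>j. PiM (case_bool (past k) (innov_idx (Suc k)) j) (\<lambda>_. count_space UNIV))
     (\<lambda>j \<omega>. restrict (\<lambda>i. Z i \<omega>) (case_bool (past k) (innov_idx (Suc k)) j)) UNIV"
    using past_subset
    by (intro indep_vars_restrict[OF indep])
      (auto split: bool.split simp: disjoint_family_on_def past_def innov_idx_def)
  then show ?thesis
    unfolding indep_var_def
    by (rule indep_vars_cong[THEN iffD1, rotated -1]) (auto split: bool.split)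
qed

section \<open>The normalised martingale\<close>

definition gram :: "(inar_idx \<Rightarrow> nat) \<Rightarrow> nat \<Rightarrow> real" where
  "gram z k = 1 + (\<Sum>i\<le>k. (real (traj z i))\<^sup>2)"

text \<open>Predictable: only generations up to \<open>k\<close> enter, so multiplying the next
  innovation by it keeps the increment centred given the past.\<close>

definition weight :: "nat \<Rightarrow> (inar_idx \<Rightarrow> nat) \<Rightarrow> real" where
  "weight k z = real (traj z k) / gram z k"

definition step :: "nat \<Rightarrow> 'w \<Rightarrow> real" where
  "step k \<omega> = weight k (\<lambda>i. Z i \<omega>) * innov (Suc k) (X k \<omega>) (\<lambda>i. Z i \<omega>)"

text \<open>The sigma-algebra generated by the past coordinates. As a preimage algebra, it turns
  each of its events into a condition on the restricted family alone.\<close>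

definition history :: "nat \<Rightarrow> 'w measure" where
  "history k = vimage_algebra (space M) (\<lambda>\<omega>. restrict (\<lambda>i. Z i \<omega>) (past k)) (PiM (past k) (\<lambda>_. count_space UNIV))"

lemma space_history: "space (history k) = space M"
  by (simp add: history_def)

lemma measurable_history: "i \<in> past k \<Longrightarrow> Z i \<in> measurable (history k) (count_space UNIV)"
proof -
  assume i: "i \<in> past k"
  have "(\<lambda>\<omega>. restrict (\<lambda>i. Z i \<omega>) (past k)) \<in> measurable (history k) (PiM (past k) (\<lambda>_. count_space UNIV))"
    unfolding history_def by (rule measurable_vimage_algebra1) (auto simp: space_PiM)
  from measurable_compose[OF this measurable_component_singleton[OF i]]
  show ?thesis using i by simp
qed

text \<open>\<open>history k\<close> is the smallest sigma-algebra making the past coordinates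
  measurable. A general \<open>N\<close> covers both inclusion in \<open>M\<close> and monotonicity
  of the filtration.\<close>

lemma subalgebra_history:
  assumes "space N = space M" "\<And>i. i \<in> past k \<Longrightarrow> Z i \<in> measurable N (count_space UNIV)"
  shows "subalgebra N (history k)"
  unfolding subalgebra_def space_history assms(1)
proof (intro conjI refl)
  have "(\<lambda>\<omega>. restrict (\<lambda>i. Z i \<omega>) (past k)) \<in> measurable N (PiM (past k) (\<lambda>_. count_space UNIV))"
    by (intro measurable_restrict assms(2))
  then have "(\<lambda>\<omega>. \<omega>) \<in> measurable N (history k)"
    unfolding history_def by (intro measurable_vimage_algebra2) (auto simp: assms(1))
  then show "sets (history k) \<subseteq> sets N"
    using sets.sets_into_space[of _ "history k"]
    by (auto dest!: measurable_sets simp: assms(1) space_history Int_absorb2 subset_iff)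
qed

lemma gram_ge_1: "gram z k \<ge> 1"
  by (simp add: gram_def sum_nonneg)

lemma square_traj_le_gram: "(real (traj z k))\<^sup>2 \<le> gram z k"
proof -
  have "(real (traj z k))\<^sup>2 \<le> (\<Sum>i\<le>k. (real (traj z i))\<^sup>2)" by (intro member_le_sum) auto
  then show ?thesis by (simp add: gram_def)
qed

lemma weight_restrict: "past k \<subseteq> J \<Longrightarrow> weight k (restrict z J) = weight k z"
proof -
  assume J: "past k \<subseteq> J"
  have "traj (restrict z J) i = traj z i" if "i \<le> k" for i
    using past_mono[OF that] J by (intro traj_restrict) auto
  then show ?thesis by (simp add: weight_def gram_def)
qed

lemma measurable_weight [measurable (raw)]:
  assumes "\<And>i. i \<in> past k \<Longrightarrow> (\<lambda>x. z x i) \<in> measurable N (count_space UNIV)"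
  shows "(\<lambda>x. weight k (z x)) \<in> borel_measurable N"
proof -
  have [measurable]: "(\<lambda>x. traj (z x) i) \<in> measurable N (count_space UNIV)" if "i \<le> k" for i
    using past_mono[OF that] assms by (intro measurable_traj) auto
  show ?thesis unfolding weight_def gram_def by measurable
qed

lemma measurable_innov [measurable (raw)]:
  assumes "\<And>i. i \<in> innov_idx k \<Longrightarrow> (\<lambda>y. z y i) \<in> measurable N (count_space UNIV)"
    and "f \<in> measurable N (count_space UNIV)"
  shows "(\<lambda>y. innov k (f y) (z y)) \<in> borel_measurable N"
proof (rule measurable_compose_countable[OF _ assms(2)])
  fix x
  have [measurable]: "(\<lambda>y. z y i) \<in> measurable N (count_space UNIV)" if "i \<in> used_idx k x" for i
    using that used_idx_subset assms(1) by auto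
  show "(\<lambda>y. innov k x (z y)) \<in> borel_measurable N"
    unfolding innov_def by measurable
qed

lemma innov_restrict: "innov k x (restrict z (innov_idx k)) = innov k x z"
  unfolding innov_def using used_idx_subset by (intro sum.cong) auto

text \<open>Both \<open>traj z k\<close> and 1 are at most the square root of the Gram sum, so one
  half power of the denominator pays for the linear growth of the variance. The result has the form
  summed in \<open>sum_increments_over_powr_three_halves\<close>.\<close>

lemma weighted_variance_le:
  "(weight k z)\<^sup>2 * (noise_bound * (real (traj z k) + 1)) \<le> 2 * noise_bound * ((real (traj z k))\<^sup>2 / (gram z k * sqrt (gram z k)))"
proof -
  define x G where "x = real (traj z k)" and "G = gram z k"
  have G: "G \<ge> 1" unfolding G_def by (rule gram_ge_1)
  have "x \<le> sqrt G" using square_traj_le_gram[of z k] unfolding x_def G_def by (rule real_le_rsqrt)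
  moreover have "1 \<le> sqrt G" using G by simp
  ultimately have "x + 1 \<le> 2 * sqrt G" by linarith
  then have "(x / G)\<^sup>2 * (noise_bound * (x + 1)) \<le> (x / G)\<^sup>2 * (noise_bound * (2 * sqrt G))"
    using noise_bound_ge_1 by (intro mult_left_mono) auto
  also have "\<dots> = 2 * noise_bound * (x\<^sup>2 / (G * (G / sqrt G)))"
    using G by (simp add: power2_eq_square field_simps)
  also have "G / sqrt G = sqrt G" using G by (simp add: real_div_sqrt)
  finally show ?thesis by (simp add: weight_def x_def G_def)
qed


lemma nn_integral_step_square:
  "(\<integral>\<^sup>+\<omega>. ennreal ((step k \<omega>)\<^sup>2) \<partial>M)
     \<le> (\<integral>\<^sup>+\<omega>. ennreal (2 * noise_bound * ((real (X k \<omega>))\<^sup>2 / (gram (\<lambda>i. Z i \<omega>) k * sqrt (gram (\<lambda>i. Z i \<omega>) k)))) \<partial>M)"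
proof -
  let ?P = "PiM (past k) (\<lambda>_. count_space UNIV :: nat measure)"
  let ?I = "PiM (innov_idx (Suc k)) (\<lambda>_. count_space UNIV :: nat measure)"
  let ?p = "\<lambda>\<omega>. restrict (\<lambda>i. Z i \<omega>) (past k)" and ?q = "\<lambda>\<omega>. restrict (\<lambda>i. Z i \<omega>) (innov_idx (Suc k))"
  define h where "h = (\<lambda>(p, q). ennreal ((weight k p * innov (Suc k) (traj p k) q)\<^sup>2))"
  have h: "h \<in> borel_measurable (?P \<Otimes>\<^sub>M ?I)"
    unfolding h_def case_prod_beta by measurable
  \<comment> \<open>Two sample points: \<open>\<omega>\<close> supplies the past, hence weight and
    population size, and \<open>\<omega>'\<close> supplies only the fresh variables.\<close>
  have h_eq: "h (?p \<omega>, ?q \<omega>') = ennreal ((weight k (\<lambda>i. Z i \<omega>))\<^sup>2) * ennreal ((innov (Suc k) (X k \<omega>) (\<lambda>i. Z i \<omega>'))\<^sup>2)"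
    for \<omega> \<omega>'
    by (simp add: h_def weight_restrict traj_restrict innov_restrict power_mult_distrib ennreal_mult)
  have [measurable]: "(\<lambda>\<omega>. innov (Suc k) x (\<lambda>i. Z i \<omega>)) \<in> borel_measurable M" for x
    using innov_moments(1) by (rule borel_measurable_integrable)
  have "(\<integral>\<^sup>+\<omega>. ennreal ((step k \<omega>)\<^sup>2) \<partial>M) = (\<integral>\<^sup>+\<omega>. h (?p \<omega>, ?q \<omega>) \<partial>M)"
    unfolding h_eq by (simp add: step_def power_mult_distrib ennreal_mult)
  also have "\<dots> = (\<integral>\<^sup>+\<omega>. \<integral>\<^sup>+\<omega>'. h (?p \<omega>, ?q \<omega>') \<partial>M \<partial>M)"
    by (rule nn_integral_indep_var[OF indep_past_innov h])
  also have "\<dots> = (\<integral>\<^sup>+\<omega>. ennreal ((weight k (\<lambda>i. Z i \<omega>))\<^sup>2)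
      * ennreal (expectation (\<lambda>\<omega>'. (innov (Suc k) (X k \<omega>) (\<lambda>i. Z i \<omega>'))\<^sup>2)) \<partial>M)"
    unfolding h_eq by (simp add: nn_integral_cmult nn_integral_eq_integral innov_moments(3))
  also have "\<dots> \<le> (\<integral>\<^sup>+\<omega>. ennreal (2 * noise_bound * ((real (X k \<omega>))\<^sup>2 / (gram (\<lambda>i. Z i \<omega>) k * sqrt (gram (\<lambda>i. Z i \<omega>) k)))) \<partial>M)"
  proof (rule nn_integral_mono)
    fix \<omega>
    let ?z = "\<lambda>i. Z i \<omega>"
    have "(weight k ?z)\<^sup>2 * expectation (\<lambda>\<omega>'. (innov (Suc k) (X k \<omega>) (\<lambda>i. Z i \<omega>'))\<^sup>2)
        \<le> (weight k ?z)\<^sup>2 * (noise_bound * (real (X k \<omega>) + 1))"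
      by (intro mult_left_mono innov_moments(4)) auto
    also note weighted_variance_le[of k ?z]
    finally show "ennreal ((weight k ?z)\<^sup>2) * ennreal (expectation (\<lambda>\<omega>'. (innov (Suc k) (X k \<omega>) (\<lambda>i. Z i \<omega>'))\<^sup>2))
        \<le> ennreal (2 * noise_bound * ((real (X k \<omega>))\<^sup>2 / (gram ?z k * sqrt (gram ?z k))))"
      by (simp add: ennreal_mult[symmetric] ennreal_leI)
  qed
  finally show ?thesis .
qed

lemma measurable_gram [measurable]: "(\<lambda>\<omega>. gram (\<lambda>i. Z i \<omega>) k) \<in> borel_measurable M"
  unfolding gram_def by measurable

lemma step_eq:
  "step k \<omega> = real (X k \<omega>) * (real (X (Suc k) \<omega>) - \<alpha> * real (X k \<omega>) - mu) / gram (\<lambda>i. Z i \<omega>) k"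
  by (simp add: step_def weight_def innov_traj)

lemma measurable_step [measurable]: "step k \<in> borel_measurable M"
  unfolding step_eq[abs_def] by measurable

lemma step_square_integrable: "integrable M (\<lambda>\<omega>. (step k \<omega>)\<^sup>2)"
  and step_square_le: "expectation (\<lambda>\<omega>. (step k \<omega>)\<^sup>2)
    \<le> expectation (\<lambda>\<omega>. 2 * noise_bound * ((real (X k \<omega>))\<^sup>2 / (gram (\<lambda>i. Z i \<omega>) k * sqrt (gram (\<lambda>i. Z i \<omega>) k))))"
  and integrable_step_bound: "integrable M
    (\<lambda>\<omega>. 2 * noise_bound * ((real (X k \<omega>))\<^sup>2 / (gram (\<lambda>i. Z i \<omega>) k * sqrt (gram (\<lambda>i. Z i \<omega>) k))))"
proof -
  let ?b = "\<lambda>\<omega>. (real (X k \<omega>))\<^sup>2 / (gram (\<lambda>i. Z i \<omega>) k * sqrt (gram (\<lambda>i. Z i \<omega>) k))"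
  \<comment> \<open>A bound by 1 makes the dominating variable integrable without any moment of the
    process; finiteness of the second moment of \<open>step k\<close> follows.\<close>
  have b: "0 \<le> ?b \<omega>" "?b \<omega> \<le> 1" for \<omega>
  proof -
    define G where "G = gram (\<lambda>i. Z i \<omega>) k"
    have G: "G \<ge> 1" unfolding G_def by (rule gram_ge_1)
    have "(real (X k \<omega>))\<^sup>2 \<le> G" unfolding G_def by (rule square_traj_le_gram)
    also have "G * 1 \<le> G * sqrt G" using G by (intro mult_left_mono) auto
    finally show "?b \<omega> \<le> 1" using G unfolding G_def[symmetric] by (simp add: divide_le_eq)
    show "0 \<le> ?b \<omega>" using G unfolding G_def[symmetric] by simp
  qed
  have "integrable M ?b" using b by (intro integrable_const_bound[where B=1] AE_I2) (simp_all add: abs_of_nonneg del: abs_divide)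
  then show int: "integrable M (\<lambda>\<omega>. 2 * noise_bound * ?b \<omega>)" by (rule integrable_mult_right)
  have nn: "0 \<le> 2 * noise_bound * ?b \<omega>" for \<omega> using b(1)[of \<omega>] noise_bound_ge_1 by (intro mult_nonneg_nonneg) auto
  have le: "(\<integral>\<^sup>+\<omega>. ennreal ((step k \<omega>)\<^sup>2) \<partial>M) \<le> ennreal (expectation (\<lambda>\<omega>. 2 * noise_bound * ?b \<omega>))"
    using nn_integral_step_square[of k] by (simp only: nn_integral_eq_integral[OF int AE_I2[OF nn]])
  then show i: "integrable M (\<lambda>\<omega>. (step k \<omega>)\<^sup>2)"
    by (intro integrableI_nonneg) (auto simp: less_top[symmetric] top_unique)
  show "expectation (\<lambda>\<omega>. (step k \<omega>)\<^sup>2) \<le> expectation (\<lambda>\<omega>. 2 * noise_bound * ?b \<omega>)"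
    using le nn by (simp add: nn_integral_eq_integral[OF i] ennreal_le_iff integral_nonneg)
qed

text \<open>Sum and expectation are exchanged first, because the telescoping bound holds path by
  path and uniformly in \<open>n\<close>.\<close>

lemma summable_step_square: "summable (\<lambda>k. expectation (\<lambda>\<omega>. (step k \<omega>)\<^sup>2))"
proof (rule summableI_nonneg_bounded)
  fix n
  let ?b = "\<lambda>k \<omega>. (real (X k \<omega>))\<^sup>2 / (gram (\<lambda>i. Z i \<omega>) k * sqrt (gram (\<lambda>i. Z i \<omega>) k))"
  have "(\<Sum>k<n. expectation (\<lambda>\<omega>. (step k \<omega>)\<^sup>2)) \<le> (\<Sum>k<n. expectation (\<lambda>\<omega>. 2 * noise_bound * ?b k \<omega>))"
    by (intro sum_mono step_square_le)
  also have "\<dots> = expectation (\<lambda>\<omega>. \<Sum>k<n. 2 * noise_bound * ?b k \<omega>)"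
    by (rule Bochner_Integration.integral_sum[symmetric]) (rule integrable_step_bound)
  also have "\<dots> \<le> expectation (\<lambda>\<omega>. 2 * noise_bound * 2)"
  proof (rule integral_mono)
    show "integrable M (\<lambda>\<omega>. \<Sum>k<n. 2 * noise_bound * ?b k \<omega>)"
      by (rule Bochner_Integration.integrable_sum) (rule integrable_step_bound)
    show "(\<Sum>k<n. 2 * noise_bound * ?b k \<omega>) \<le> 2 * noise_bound * 2" for \<omega>
      unfolding sum_distrib_left[symmetric] gram_def using noise_bound_ge_1
      by (intro mult_left_mono sum_increments_over_powr_three_halves) auto
  qed simp
  also have "\<dots> = 2 * noise_bound * 2" by (simp add: prob_space)
  finally show "(\<Sum>k<n. expectation (\<lambda>\<omega>. (step k \<omega>)\<^sup>2)) \<le> 2 * noise_bound * 2" .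
qed simp

text \<open>The indicator of \<open>A\<close> and the weight depend on the past block only, so
  freezing that block leaves a multiple of a centred innovation.\<close>

lemma integral_step_history_eq_0:
  assumes A: "A \<in> sets (history k)"
  shows "(\<integral>\<omega>\<in>A. step k \<omega> \<partial>M) = 0"
proof -
  let ?P = "PiM (past k) (\<lambda>_. count_space UNIV :: nat measure)"
  let ?I = "PiM (innov_idx (Suc k)) (\<lambda>_. count_space UNIV :: nat measure)"
  let ?p = "\<lambda>\<omega>. restrict (\<lambda>i. Z i \<omega>) (past k)" and ?q = "\<lambda>\<omega>. restrict (\<lambda>i. Z i \<omega>) (innov_idx (Suc k))"
  obtain B where B[measurable]: "B \<in> sets ?P" and AB: "A = ?p -` B \<inter> space M"
    using A unfolding history_def by (subst (asm) sets_vimage_algebra2) (auto simp: space_PiM)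
  have AM: "A \<in> events"
    using A subalgebra_history[of M k] past_subset by (auto simp: subalgebra_def intro: meas)
  define h where "h = (\<lambda>(p, q). indicator B p * (weight k p * innov (Suc k) (traj p k) q))"
  have h: "h \<in> borel_measurable (?P \<Otimes>\<^sub>M ?I)"
    unfolding h_def case_prod_beta by measurable
  have h_eq: "h (?p \<omega>, ?q \<omega>) = indicator A \<omega> * step k \<omega>" if "\<omega> \<in> space M" for \<omega>
    using that by (simp add: h_def weight_restrict traj_restrict innov_restrict step_def AB indicator_def)
  have "integrable M (step k)"
    using step_square_integrable by (rule square_integrable_imp_integrable[rotated]) measurable
  then have "integrable M (\<lambda>\<omega>. indicator A \<omega> * step k \<omega>)"
    using integrable_mult_indicator[OF AM, of "step k"] by simp
  then have int: "integrable M (\<lambda>\<omega>. h (?p \<omega>, ?q \<omega>))"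
    by (rule Bochner_Integration.integrable_cong[THEN iffD1, rotated -1]) (auto simp: h_eq)
  have "(\<integral>\<omega>\<in>A. step k \<omega> \<partial>M) = (\<integral>\<omega>. h (?p \<omega>, ?q \<omega>) \<partial>M)"
    unfolding set_lebesgue_integral_def by (intro Bochner_Integration.integral_cong) (auto simp: h_eq)
  also have "\<dots> = 0"
    by (rule integral_indep_var_eq_0[OF indep_past_innov h int])
      (simp only: h_def innov_restrict case_prod_conv integral_mult_right_zero innov_moments(2) mult_zero_right)
  finally show ?thesis .
qed

lemma step_martingale_differences: "square_integrable_martingale_differences M history step"
proof unfold_locales
  fix n
  show sub: "subalgebra M (history n)"
    using past_subset by (intro subalgebra_history meas) auto
  show "subalgebra (history (Suc n)) (history n)"
    using past_mono[of n "Suc n"] by (intro subalgebra_history measurable_history) (auto simp: space_history)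
  have [measurable]: "X k \<in> measurable (history (Suc n)) (count_space UNIV)" if "k \<le> Suc n" for k
    using past_mono[OF that] by (intro measurable_traj measurable_history) auto
  show "step n \<in> borel_measurable (history (Suc n))"
    unfolding step_eq[abs_def] gram_def by measurable
  show "integrable M (\<lambda>\<omega>. (step n \<omega>)\<^sup>2)" by (rule step_square_integrable)
  then have int: "integrable M (step n)"
    by (rule square_integrable_imp_integrable[rotated]) measurable
  interpret H: finite_measure_subalgebra M "history n"
    by unfold_locales (rule sub)
  show "AE \<omega> in M. real_cond_exp M (history n) (step n) \<omega> = 0"
    by (rule H.real_cond_exp_charact) (use integral_step_history_eq_0 int in \<open>auto simp: set_lebesgue_integral_def\<close>)
qed

lemma AE_summable_step: "AE \<omega> in M. summable (\<lambda>k. step k \<omega>)"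
  by (rule square_integrable_martingale_differences.AE_summable[OF step_martingale_differences summable_step_square])

section \<open>Divergence of the Gram sums and negligible residuals\<close>

text \<open>A direct Borel-Cantelli argument: by independence, \<open>Suc n\<close> consecutive zero
  innovations have probability \<open>p ^ Suc n\<close> with \<open>p < 1\<close>, so zeros forever
  have probability zero.\<close>

lemma AE_eps_frequently_nonzero: "AE \<omega> in M. \<forall>m. \<exists>k\<ge>m. Z (IEps (Suc k)) \<omega> \<noteq> 0"
proof -
  have eps[measurable]: "Z (IEps (Suc k)) \<in> measurable M (count_space UNIV)" for k
    by (rule meas) (simp add: inar_index_def)
  define p where "p = prob {\<omega> \<in> space M. Z (IEps 1) \<omega> = 0}"
  have p: "0 \<le> p" "p < 1"
  proof -
    have "{\<omega> \<in> space M. Z (IEps 1) \<omega> = 0} = space M - {\<omega> \<in> space M. Z (IEps 1) \<omega> \<noteq> 0}" by auto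
    then have "p = 1 - prob {\<omega> \<in> space M. Z (IEps 1) \<omega> \<noteq> 0}"
      unfolding p_def using eps[of 0] by (simp add: prob_compl)
    then show "p < 1" using eps_nz by simp
  qed (simp add: p_def)
  have pk: "prob (Z (IEps (Suc k)) -` {0} \<inter> space M) = p" for k
  proof -
    have "prob (Z (IEps (Suc k)) -` {0} \<inter> space M) = measure (distr M (count_space UNIV) (Z (IEps (Suc k)))) {0}"
      by (rule measure_distr[symmetric]) auto
    also have "\<dots> = prob (Z (IEps 1) -` {0} \<inter> space M)"
      using measure_distr[OF eps[of 0], of "{0}"] eps_id[of "Suc k"] by simp
    also have "\<dots> = p" unfolding p_def by (rule arg_cong[where f=prob]) auto
    finally show ?thesis .
  qed
  have "AE \<omega> in M. \<exists>k\<ge>m. Z (IEps (Suc k)) \<omega> \<noteq> 0" for m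
  proof -
    define N where "N = {\<omega> \<in> space M. \<forall>k\<ge>m. Z (IEps (Suc k)) \<omega> = 0}"
    have [measurable]: "N \<in> events" unfolding N_def by measurable
    have "prob N \<le> p ^ Suc n" for n
    proof -
      let ?J = "(\<lambda>k. IEps (Suc k)) ` {m..m + n}"
      have "N \<subseteq> (\<Inter>i\<in>?J. Z i -` {0} \<inter> space M)" by (auto simp: N_def)
      then have "prob N \<le> prob (\<Inter>i\<in>?J. Z i -` {0} \<inter> space M)"
      proof (rule finite_measure_mono)
        show "(\<Inter>i\<in>?J. Z i -` {0} \<inter> space M) \<in> events"
          by (intro sets.finite_INT) (auto intro!: measurable_sets[OF eps])
      qed
      also have "\<dots> = (\<Prod>i\<in>?J. prob (Z i -` {0} \<inter> space M))"
        by (rule indep_varsD[OF indep]) (auto simp: inar_index_def)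
      also have "\<dots> = p ^ Suc n"
        by (subst prod.reindex) (auto simp: inj_on_def pk)
      finally show ?thesis .
    qed
    moreover have "(\<lambda>n. p ^ Suc n) \<longlonglongrightarrow> 0"
      using p by (intro LIMSEQ_Suc LIMSEQ_power_zero) auto
    ultimately have "prob N \<le> 0" by (intro LIMSEQ_le_const) auto
    then have "prob N = 0" using measure_nonneg[of M N] by linarith
    then have "AE \<omega> in M. \<omega> \<notin> N" by (simp add: prob_eq_0)
    with AE_space show ?thesis by eventually_elim (auto simp: N_def)
  qed
  then show ?thesis by (simp add: AE_all_countable)
qed

lemma mono_gram: "mono (gram z)"
  unfolding gram_def by (intro monoI add_left_mono sum_mono2) auto

text \<open>Each nonzero immigration makes the population at least 1 and so raises the Gram sum by
  at least 1; this happens infinitely often.\<close>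

lemma AE_gram_at_top: "AE \<omega> in M. filterlim (gram (\<lambda>i. Z i \<omega>)) at_top sequentially"
  using AE_eps_frequently_nonzero
proof eventually_elim
  case (elim \<omega>)
  let ?z = "\<lambda>i. Z i \<omega>"
  have "\<exists>m. gram ?z m \<ge> real n" for n
  proof (induction n)
    case 0 then show ?case using gram_ge_1[of ?z 0] by (intro exI[of _ 0]) simp
  next
    case (Suc n)
    then obtain m where m: "gram ?z m \<ge> real n" by blast
    obtain k where k: "k \<ge> m" "?z (IEps (Suc k)) \<noteq> 0" using elim by blast
    then have "traj ?z (Suc k) \<ge> 1" by (simp add: traj_Suc)
    then have "(real (traj ?z (Suc k)))\<^sup>2 \<ge> 1" by simp
    moreover have "gram ?z m \<le> gram ?z k" using mono_gram k(1) by (auto simp: mono_def)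
    ultimately have "gram ?z (Suc k) \<ge> real (Suc n)" using m by (simp add: gram_def)
    then show ?case ..
  qed
  then show ?case
    unfolding filterlim_at_top eventually_sequentially
    by (metis mono_gram monoD order_trans real_arch_simple)
qed

text \<open>Kronecker's lemma with the Gram sums as weights, which cancel the denominators in
  \<open>step\<close>.\<close>

lemma AE_weighted_residuals_negligible:
  "AE \<omega> in M. (\<lambda>n. (\<Sum>k\<le>n. real (X k \<omega>) * (real (X (Suc k) \<omega>) - \<alpha> * real (X k \<omega>) - mu))
     / gram (\<lambda>i. Z i \<omega>) n) \<longlonglongrightarrow> 0"
  using AE_gram_at_top AE_summable_step
proof eventually_elim
  case (elim \<omega>)
  let ?z = "\<lambda>i. Z i \<omega>"
  have "gram ?z k \<noteq> 0" "gram ?z 0 \<ge> 0" for k using gram_ge_1[of ?z k] gram_ge_1[of ?z 0] by auto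
  then show ?case
    using kronecker_lemma[OF elim(2) mono_gram _ elim(1)] by (simp add: step_eq)
qed

section \<open>From the process to the contaminated observations\<close>

text \<open>Omitting \<open>k = s\<close> and \<open>k = s + 1\<close> removes exactly the summands
  containing the contaminated value, so the sums are those of the clean process up to constants,
  which division by a diverging Gram sum makes negligible.\<close>

lemma AE_outlier_least_squares_consistent:
  fixes s \<theta> :: nat
  assumes s: "s \<ge> 1"
  defines "Y \<equiv> \<lambda>\<omega> k. real (outlier_Y s \<theta> (traj (\<lambda>i. Z i \<omega>)) k)"
  shows "AE \<omega> in M.
     filterlim (\<lambda>n. \<Sum>k\<in>{1..n} - {s, s + 1}. (Y \<omega> (k - 1))\<^sup>2) at_top sequentially \<and>
     (\<lambda>n. (\<Sum>k\<in>{1..n} - {s, s + 1}. Y \<omega> (k - 1) * (Y \<omega> k - \<alpha> * Y \<omega> (k - 1) - mu))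
        / (\<Sum>k\<in>{1..n} - {s, s + 1}. (Y \<omega> (k - 1))\<^sup>2)) \<longlonglongrightarrow> 0"
proof -
  have Y: "Y \<omega> k = real (X k \<omega>)" if "k \<noteq> s" for \<omega> k
    using that by (simp add: Y_def outlier_Y_def)
  show ?thesis
    using AE_gram_at_top AE_weighted_residuals_negligible
  proof eventually_elim
    case (elim \<omega>)
    define x where "x k = real (X k \<omega>)" for k
    define r where "r k = x k * (x (Suc k) - \<alpha> * x k - mu)" for k
    define G where "G = gram (\<lambda>i. Z i \<omega>)"
    \<comment> \<open>The extra 1 is the one built into \<open>gram\<close>; the squares belong to
      the two omitted indices.\<close>
    define c where "c = 1 + (x (s - 1))\<^sup>2 + (x s)\<^sup>2"
    define c' where "c' = r (s - 1) + r s"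
    \<comment> \<open>Summation to \<open>Suc n\<close> in \<open>k\<close> matches summation to
      \<open>n\<close> in \<open>k - 1\<close>. The condition \<open>n\<close> \<ge>
      \<open>s\<close> ensures that both omitted indices lie in the range.\<close>
    have split: "(\<Sum>k\<in>{1..Suc n} - {s, s + 1}. f (k - 1)) = (\<Sum>k\<le>n. f k) - (f (s - 1) + f s)"
      if n: "n \<ge> s" for n and f :: "nat \<Rightarrow> real"
    proof -
      have "(\<Sum>k\<in>{1..Suc n} - {s, s + 1}. f (k - 1)) = (\<Sum>k\<in>{1..Suc n}. f (k - 1)) - (\<Sum>k\<in>{s, s + 1}. f (k - 1))"
        using n s by (intro sum_diff) auto
      also have "(\<Sum>k\<in>{1..Suc n}. f (k - 1)) = (\<Sum>k\<le>n. f k)"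
        by (induction n) simp_all
      finally show ?thesis by simp
    qed
    have gram: "(\<Sum>k\<in>{1..Suc n} - {s, s + 1}. (Y \<omega> (k - 1))\<^sup>2) = G n - c" if "n \<ge> s" for n
    proof -
      have "(\<Sum>k\<in>{1..Suc n} - {s, s + 1}. (Y \<omega> (k - 1))\<^sup>2) = (\<Sum>k\<in>{1..Suc n} - {s, s + 1}. (x (k - 1))\<^sup>2)"
        by (intro sum.cong) (auto simp: Y x_def)
      then show ?thesis using split[OF that, of "\<lambda>k. (x k)\<^sup>2"]
        by (simp add: G_def c_def gram_def x_def)
    qed
    have res: "(\<Sum>k\<in>{1..Suc n} - {s, s + 1}. Y \<omega> (k - 1) * (Y \<omega> k - \<alpha> * Y \<omega> (k - 1) - mu))
        = (\<Sum>k\<le>n. r k) - c'" if "n \<ge> s" for n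
    proof -
      have "(\<Sum>k\<in>{1..Suc n} - {s, s + 1}. Y \<omega> (k - 1) * (Y \<omega> k - \<alpha> * Y \<omega> (k - 1) - mu))
          = (\<Sum>k\<in>{1..Suc n} - {s, s + 1}. r (k - 1))"
        by (intro sum.cong) (auto simp: Y x_def r_def)
      then show ?thesis using split[OF that, of r] by (simp add: c'_def)
    qed
    have G: "filterlim G at_top sequentially" using elim(1) by (simp add: G_def)
    have "(\<lambda>n. (\<Sum>k\<le>n. r k) / G n) \<longlonglongrightarrow> 0"
      using elim(2) by (simp add: r_def x_def G_def)
    then have "(\<lambda>n. ((\<Sum>k\<le>n. r k) / G n - c' / G n) / (1 - c / G n)) \<longlonglongrightarrow> (0 - 0) / (1 - 0)"
      using real_tendsto_divide_at_top[OF tendsto_const G]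
      by (intro tendsto_divide tendsto_diff[of _ 0] tendsto_diff[of _ 1] tendsto_const) auto
    moreover have "eventually (\<lambda>n. ((\<Sum>k\<le>n. r k) / G n - c' / G n) / (1 - c / G n)
        = (\<Sum>k\<in>{1..Suc n} - {s, s + 1}. Y \<omega> (k - 1) * (Y \<omega> k - \<alpha> * Y \<omega> (k - 1) - mu))
        / (\<Sum>k\<in>{1..Suc n} - {s, s + 1}. (Y \<omega> (k - 1))\<^sup>2)) sequentially"
      using eventually_ge_at_top[of s]
    proof eventually_elim
      case (elim n)
      have "G n \<noteq> 0" using gram_ge_1[of "\<lambda>i. Z i \<omega>" n] by (auto simp: G_def)
      then have "G n * (1 - c / G n) = G n - c" by (simp add: algebra_simps)
      then have "((\<Sum>k\<le>n. r k) / G n - c' / G n) / (1 - c / G n) = ((\<Sum>k\<le>n. r k) - c') / (G n - c)"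
        by (simp add: diff_divide_distrib[symmetric])
      then show ?case by (simp only: gram[OF elim] res[OF elim])
    qed
    ultimately have "(\<lambda>n. (\<Sum>k\<in>{1..Suc n} - {s, s + 1}. Y \<omega> (k - 1) * (Y \<omega> k - \<alpha> * Y \<omega> (k - 1) - mu))
        / (\<Sum>k\<in>{1..Suc n} - {s, s + 1}. (Y \<omega> (k - 1))\<^sup>2)) \<longlonglongrightarrow> (0 - 0) / (1 - 0)"
      by (rule Lim_transform_eventually)
    then have lim: "(\<lambda>n. (\<Sum>k\<in>{1..n} - {s, s + 1}. Y \<omega> (k - 1) * (Y \<omega> k - \<alpha> * Y \<omega> (k - 1) - mu))
        / (\<Sum>k\<in>{1..n} - {s, s + 1}. (Y \<omega> (k - 1))\<^sup>2)) \<longlonglongrightarrow> 0"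
      by (subst filterlim_sequentially_Suc[symmetric]) (simp only: diff_zero div_0)
    have "filterlim (\<lambda>n. - c + G n) at_top sequentially"
      by (rule filterlim_tendsto_add_at_top[OF tendsto_const G])
    moreover have "eventually (\<lambda>n. - c + G n = (\<Sum>k\<in>{1..Suc n} - {s, s + 1}. (Y \<omega> (k - 1))\<^sup>2)) sequentially"
      using eventually_ge_at_top[of s] by eventually_elim (subst gram, simp_all)
    ultimately have "filterlim (\<lambda>n. \<Sum>k\<in>{1..Suc n} - {s, s + 1}. (Y \<omega> (k - 1))\<^sup>2) at_top sequentially"
      by (rule filterlim_cong[OF refl refl, THEN iffD1, rotated])
    then have "filterlim (\<lambda>n. \<Sum>k\<in>{1..n} - {s, s + 1}. (Y \<omega> (k - 1))\<^sup>2) at_top sequentially"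
      by (subst filterlim_sequentially_Suc[symmetric])
    with lim show ?case by blast
  qed
qed

end

section \<open>Strong consistency\<close>

theorem theorem3p2p1:
  fixes M :: "'w measure" and Z :: "inar_idx \<Rightarrow> 'w \<Rightarrow> nat"
    and \<alpha> :: real and s \<theta> :: nat
  assumes M: "prob_space M"
    and \<alpha>: "0 < \<alpha>" "\<alpha> < 1"
    and meas: "\<And>i. i \<in> inar_index \<Longrightarrow> Z i \<in> measurable M (count_space UNIV)"
    and indep: "prob_space.indep_vars M (\<lambda>_. count_space UNIV) Z inar_index"
    and eps_id: "\<And>k. k \<ge> 1 \<Longrightarrow>
        distr M (count_space UNIV) (Z (IEps k)) = distr M (count_space UNIV) (Z (IEps 1))"
    and eps_sq: "integrable M (\<lambda>\<omega>. (real (Z (IEps 1) \<omega>))^2)"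
    and eps_nz: "measure M {\<omega> \<in> space M. Z (IEps 1) \<omega> \<noteq> 0} > 0"
    and xi_bern: "\<And>k j \<omega>. k \<ge> 1 \<Longrightarrow> j \<ge> 1 \<Longrightarrow> \<omega> \<in> space M \<Longrightarrow> Z (IXi k j) \<omega> \<le> 1"
    and xi_mean: "\<And>k j. k \<ge> 1 \<Longrightarrow> j \<ge> 1 \<Longrightarrow>
        measure M {\<omega> \<in> space M. Z (IXi k j) \<omega> = 1} = \<alpha>"
    and X0_sq: "integrable M (\<lambda>\<omega>. (real (Z IX0 \<omega>))^2)"
    and s: "s \<ge> 1" and \<theta>: "\<theta> \<ge> 1"
  defines "mu \<equiv> integral\<^sup>L M (\<lambda>\<omega>. real (Z (IEps 1) \<omega>))"
    and "Y \<equiv> (\<lambda>\<omega> k. real (outlier_Y s \<theta>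
              (inar (Z IX0 \<omega>) (\<lambda>k. Z (IEps k) \<omega>) (\<lambda>k j. Z (IXi k j) \<omega>)) k))"
  shows "(AE \<omega> in M. \<exists>n0. \<forall>n\<ge>n0. \<exists>!p. is_min_Qn mu s n (Y \<omega>) p)
       \<and> (AE \<omega> in M. (\<lambda>n. fst (argmin_Qn mu s n (Y \<omega>))) \<longlonglongrightarrow> \<alpha>)
       \<and> (AE \<omega> in M. (\<lambda>n. snd (argmin_Qn mu s n (Y \<omega>))) \<longlonglongrightarrow>
             Y \<omega> s - \<alpha> / (1 + \<alpha>^2) * (Y \<omega> (s-1) + Y \<omega> (s+1))
             - (1 - \<alpha>) / (1 + \<alpha>^2) * mu)"
proof -
  interpret prob_space M by (rule M)
  have P: "inar_process M Z \<alpha>"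
    by unfold_locales (fact meas indep eps_id eps_sq eps_nz xi_bern xi_mean)+
  have mu: "mu = inar_process.mu M Z"
    by (simp add: mu_def inar_process.mu_def[OF P])
  have Y: "Y = (\<lambda>\<omega> k. real (outlier_Y s \<theta> (inar_process.traj (\<lambda>i. Z i \<omega>)) k))"
    by (simp add: Y_def inar_process.traj_def[OF P])
  \<comment> \<open>All randomness is confined to this one almost sure event; on it the pathwise
    lemma yields the three conclusions.\<close>
  have main: "AE \<omega> in M.
     filterlim (\<lambda>n. \<Sum>k\<in>{1..n} - {s, s + 1}. (Y \<omega> (k - 1))\<^sup>2) at_top sequentially \<and>
     (\<lambda>n. (\<Sum>k\<in>{1..n} - {s, s + 1}. Y \<omega> (k - 1) * (Y \<omega> k - \<alpha> * Y \<omega> (k - 1) - mu))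
        / (\<Sum>k\<in>{1..n} - {s, s + 1}. (Y \<omega> (k - 1))\<^sup>2)) \<longlonglongrightarrow> 0"
    unfolding Y mu by (rule inar_process.AE_outlier_least_squares_consistent[OF P s])
  have 1: "AE \<omega> in M. \<exists>n0. \<forall>n\<ge>n0. \<exists>!p. is_min_Qn mu s n (Y \<omega>) p"
    \<comment> \<open>The uniqueness claim does not mention \<alpha>, so unification cannot find it
      and it is instantiated explicitly.\<close>
    using main by eventually_elim (intro argmin_Qn_consistent(1)[where \<alpha>=\<alpha>]; blast)
  have 2: "AE \<omega> in M. (\<lambda>n. fst (argmin_Qn mu s n (Y \<omega>))) \<longlonglongrightarrow> \<alpha>"
    using main by eventually_elim (intro argmin_Qn_consistent(2); blast)
  have 3: "AE \<omega> in M. (\<lambda>n. snd (argmin_Qn mu s n (Y \<omega>))) \<longlonglongrightarrow> outlier_size_fit mu s (Y \<omega>) \<alpha>"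
    using main by eventually_elim (intro argmin_Qn_consistent(3); blast)
  from 1 2 3 show ?thesis unfolding outlier_size_fit_def by blast
qed

end
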